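(* Let $\mathcal{C}$ be a semi-abelian category where, for every object $G$ and every normal subobject $H$ of $G$, the centraliser $Z_G(H)$ of $H$ in $G$ exists and is normal in $G$. Then, if $H$ is a characteristic subobject of an object $G$ of $\mathcal{C}$, the centraliser $Z_G(H)$ is also characteristic in $G$.
   Context: A normal subobject is a subobject that is the kernel of some morphism. For an object $B$ of a pointed category $\mathcal{C}$ with finite limits and finite coproducts, let $\mathrm{Pt}_B(\mathcal{C})$ be the category of points over $B$: objects are split epimorphisms $(A,p,s)$ with $p\colon A\to B$, $s\colon B\to A$, $ps=1_B$; morphisms $(A,p,s)\to(A',p',s')$ are arrows $f\colon A\to A'$ with $p'f=p$, $fs=s'$. The functor $\mathrm{Ker}_B\colon \mathrm{Pt}_B(\mathcal{C})\to\mathcal{C}$, $(A,p,s)\mapsto \mathrm{Ker}(p)$, is right adjoint to $B+(-)$, which sends $X$ to the point $(B+X,[1,0],\iota_B)$. The induced monad on $\mathcal{C}$ is denoted $B\flat(-)$, so that $B\flat X$ is the kernel of $[1,0]\colon B+X\to B$. An (internal) action of $B$ on $X$ is an algebra $\xi\colon B\flat X\to X$ for this monad. A subobject $h\colon H\rightarrowtail G$ is called characteristic in $G$ if for every object $B$ and every action $\xi\colon B\flat G\to G$ there exists a (unique) action $\overline{\xi}\colon B\flat H\to H$ with $h\,\overline{\xi}=\xi\,(1_B\flat h)$. Given subobjects $h\colon H\rightarrowtail G$ and $k\colon K\rightarrowtail G$, let $\Sigma_{H,K}=\langle[1,0],[0,1]\rangle\colon H+K\to H\times K$ be the canonical map.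 The Huq commutator $[H,K]_G$ is the kernel of $\pi\colon G\to Q$, where $\pi$ is the pushout of $\Sigma_{H,K}$ along $[h,k]\colon H+K\to G$. The centraliser $Z_G(H)$ of $H$ in $G$, when it exists, is the largest subobject of $G$ such that $[H,Z_G(H)]_G=0$. *)

theory Defs
  imports Main
begin

record ('o, 'm) cat_data =
  Obj :: "'o set"
  Arr :: "'m set"
  Dom :: "'m \<Rightarrow> 'o"
  Cod :: "'m \<Rightarrow> 'o"
  Id :: "'o \<Rightarrow> 'm"
  Comp :: "'m \<Rightarrow> 'm \<Rightarrow> 'm"

text \<open>Composition is written in the applicative order: \<open>g \<cdot> f\<close> means \<open>g\<close> after \<open>f\<close>. The value of
  \<open>Comp\<close> on pairs that are not composable, and of \<open>Id\<close> outside \<open>Obj\<close>, is unspecified.\<close>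

locale category =
  fixes C :: "('o, 'm) cat_data"
  assumes Dom_Obj: "f \<in> Arr C \<Longrightarrow> Dom C f \<in> Obj C"
    and Cod_Obj: "f \<in> Arr C \<Longrightarrow> Cod C f \<in> Obj C"
    and Id_Arr: "X \<in> Obj C \<Longrightarrow> Id C X \<in> Arr C"
    and Dom_Id: "X \<in> Obj C \<Longrightarrow> Dom C (Id C X) = X"
    and Cod_Id: "X \<in> Obj C \<Longrightarrow> Cod C (Id C X) = X"
    and Comp_Arr: "\<lbrakk>f \<in> Arr C; g \<in> Arr C; Cod C f = Dom C g\<rbrakk> \<Longrightarrow> Comp C g f \<in> Arr C"
    and Dom_Comp: "\<lbrakk>f \<in> Arr C; g \<in> Arr C; Cod C f = Dom C g\<rbrakk> \<Longrightarrow> Dom C (Comp C g f) = Dom C f"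
    and Cod_Comp: "\<lbrakk>f \<in> Arr C; g \<in> Arr C; Cod C f = Dom C g\<rbrakk> \<Longrightarrow> Cod C (Comp C g f) = Cod C g"
    and Comp_Id: "f \<in> Arr C \<Longrightarrow> Comp C f (Id C (Dom C f)) = f"
    and Id_Comp: "f \<in> Arr C \<Longrightarrow> Comp C (Id C (Cod C f)) f = f"
    and Comp_assoc: "\<lbrakk>f \<in> Arr C; g \<in> Arr C; h \<in> Arr C; Cod C f = Dom C g; Cod C g = Dom C h\<rbrakk>
      \<Longrightarrow> Comp C h (Comp C g f) = Comp C (Comp C h g) f"
begin

abbreviation comp (infixr "\<cdot>" 70) where
  "g \<cdot> f \<equiv> Comp C g f"

definition hom :: "'o \<Rightarrow> 'o \<Rightarrow> 'm set" where
  "hom X Y = {f \<in> Arr C. Dom C f = X \<and> Cod C f = Y}"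

definition monic :: "'m \<Rightarrow> bool" where
  "monic m \<longleftrightarrow> m \<in> Arr C \<and>
    (\<forall>W. \<forall>u \<in> hom W (Dom C m). \<forall>v \<in> hom W (Dom C m). m \<cdot> u = m \<cdot> v \<longrightarrow> u = v)"

definition iso :: "'m \<Rightarrow> bool" where
  "iso f \<longleftrightarrow> f \<in> Arr C \<and>
    (\<exists>g \<in> hom (Cod C f) (Dom C f). g \<cdot> f = Id C (Dom C f) \<and> f \<cdot> g = Id C (Cod C f))"


subsection \<open>Limits and colimits\<close>

definition terminal_object :: "'o \<Rightarrow> bool" where
  "terminal_object T \<longleftrightarrow> T \<in> Obj C \<and> (\<forall>X \<in> Obj C. \<exists>!f. f \<in> hom X T)"

definition initial_object :: "'o \<Rightarrow> bool" where
  "initial_object I \<longleftrightarrow> I \<in> Obj C \<and> (\<forall>X \<in> Obj C. \<exists>!f. f \<in> hom I X)"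

definition zero_object :: "'o \<Rightarrow> bool" where
  "zero_object Z \<longleftrightarrow> initial_object Z \<and> terminal_object Z"

definition product :: "'o \<Rightarrow> 'o \<Rightarrow> 'm \<Rightarrow> 'm \<Rightarrow> bool" where
  "product X Y p q \<longleftrightarrow> p \<in> hom (Dom C p) X \<and> q \<in> hom (Dom C p) Y \<and>
    (\<forall>W. \<forall>f \<in> hom W X. \<forall>g \<in> hom W Y. \<exists>!u. u \<in> hom W (Dom C p) \<and> p \<cdot> u = f \<and> q \<cdot> u = g)"

definition coproduct :: "'o \<Rightarrow> 'o \<Rightarrow> 'm \<Rightarrow> 'm \<Rightarrow> bool" where
  "coproduct X Y i j \<longleftrightarrow> i \<in> hom X (Cod C i) \<and> j \<in> hom Y (Cod C i) \<and>
    (\<forall>W. \<forall>f \<in> hom X W. \<forall>g \<in> hom Y W. \<exists>!u. u \<in> hom (Cod C i) W \<and> u \<cdot> i = f \<and> u \<cdot> j = g)"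

definition parallel :: "'m \<Rightarrow> 'm \<Rightarrow> bool" where
  "parallel f g \<longleftrightarrow> f \<in> Arr C \<and> g \<in> Arr C \<and> Dom C f = Dom C g \<and> Cod C f = Cod C g"

definition equalizer :: "'m \<Rightarrow> 'm \<Rightarrow> 'm \<Rightarrow> bool" where
  "equalizer f g e \<longleftrightarrow> parallel f g \<and> e \<in> hom (Dom C e) (Dom C f) \<and> f \<cdot> e = g \<cdot> e \<and>
    (\<forall>W. \<forall>a \<in> hom W (Dom C f). f \<cdot> a = g \<cdot> a \<longrightarrow> (\<exists>!u. u \<in> hom W (Dom C e) \<and> e \<cdot> u = a))"

definition coequalizer :: "'m \<Rightarrow> 'm \<Rightarrow> 'm \<Rightarrow> bool" where
  "coequalizer f g q \<longleftrightarrow> parallel f g \<and> q \<in> hom (Cod C f) (Cod C q) \<and> q \<cdot> f = q \<cdot> g \<and>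
    (\<forall>W. \<forall>a \<in> hom (Cod C f) W. a \<cdot> f = a \<cdot> g \<longrightarrow> (\<exists>!u. u \<in> hom (Cod C q) W \<and> u \<cdot> q = a))"

text \<open>In \<open>pullback f g p q\<close> the square is \<open>f \<cdot> p = g \<cdot> q\<close>; in \<open>pushout f g p q\<close> it is \<open>p \<cdot> f = q \<cdot> g\<close>,
  so that there \<open>q\<close> is the pushout of \<open>f\<close> along \<open>g\<close>.\<close>

definition pullback :: "'m \<Rightarrow> 'm \<Rightarrow> 'm \<Rightarrow> 'm \<Rightarrow> bool" where
  "pullback f g p q \<longleftrightarrow> f \<in> Arr C \<and> g \<in> Arr C \<and> Cod C f = Cod C g \<and>
    p \<in> hom (Dom C p) (Dom C f) \<and> q \<in> hom (Dom C p) (Dom C g) \<and> f \<cdot> p = g \<cdot> q \<and>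
    (\<forall>W. \<forall>a \<in> hom W (Dom C f). \<forall>b \<in> hom W (Dom C g). f \<cdot> a = g \<cdot> b \<longrightarrow>
      (\<exists>!u. u \<in> hom W (Dom C p) \<and> p \<cdot> u = a \<and> q \<cdot> u = b))"

definition pushout :: "'m \<Rightarrow> 'm \<Rightarrow> 'm \<Rightarrow> 'm \<Rightarrow> bool" where
  "pushout f g p q \<longleftrightarrow> f \<in> Arr C \<and> g \<in> Arr C \<and> Dom C f = Dom C g \<and>
    p \<in> hom (Cod C f) (Cod C p) \<and> q \<in> hom (Cod C g) (Cod C p) \<and> p \<cdot> f = q \<cdot> g \<and>
    (\<forall>W. \<forall>a \<in> hom (Cod C f) W. \<forall>b \<in> hom (Cod C g) W. a \<cdot> f = b \<cdot> g \<longrightarrow>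
      (\<exists>!u. u \<in> hom (Cod C p) W \<and> u \<cdot> p = a \<and> u \<cdot> q = b))"

definition pointed :: bool where
  "pointed \<longleftrightarrow> (\<exists>Z. zero_object Z)"

definition finitely_complete :: bool where
  "finitely_complete \<longleftrightarrow> (\<exists>T. terminal_object T) \<and>
    (\<forall>X \<in> Obj C. \<forall>Y \<in> Obj C. \<exists>p q. product X Y p q) \<and>
    (\<forall>f g. parallel f g \<longrightarrow> (\<exists>e. equalizer f g e))"

definition has_finite_coproducts :: bool where
  "has_finite_coproducts \<longleftrightarrow> (\<exists>I. initial_object I) \<and>
    (\<forall>X \<in> Obj C. \<forall>Y \<in> Obj C. \<exists>i j. coproduct X Y i j)"


subsection \<open>Barr exactness\<close>

definition regular_epi :: "'m \<Rightarrow> bool" where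
  "regular_epi q \<longleftrightarrow> (\<exists>f g. coequalizer f g q)"

definition kernel_pair :: "'m \<Rightarrow> 'm \<Rightarrow> 'm \<Rightarrow> bool" where
  "kernel_pair f r s \<longleftrightarrow> pullback f f r s"

definition regular :: bool where
  "regular \<longleftrightarrow> finitely_complete \<and>
    (\<forall>f r s. kernel_pair f r s \<longrightarrow> (\<exists>q. coequalizer r s q)) \<and>
    (\<forall>f g p q. pullback f g p q \<and> regular_epi f \<longrightarrow> regular_epi q)"

definition equivalence_relation :: "'m \<Rightarrow> 'm \<Rightarrow> bool" where
  "equivalence_relation r s \<longleftrightarrow> parallel r s \<and>
    (\<forall>W. \<forall>u \<in> hom W (Dom C r). \<forall>v \<in> hom W (Dom C r). r \<cdot> u = r \<cdot> v \<and> s \<cdot> u = s \<cdot> v \<longrightarrow> u = v) \<and>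
    (\<exists>d \<in> hom (Cod C r) (Dom C r). r \<cdot> d = Id C (Cod C r) \<and> s \<cdot> d = Id C (Cod C r)) \<and>
    (\<exists>t \<in> hom (Dom C r) (Dom C r). r \<cdot> t = s \<and> s \<cdot> t = r) \<and>
    (\<forall>a b. pullback s r a b \<longrightarrow>
      (\<exists>t \<in> hom (Dom C a) (Dom C r). r \<cdot> t = r \<cdot> a \<and> s \<cdot> t = s \<cdot> b))"

definition barr_exact :: bool where
  "barr_exact \<longleftrightarrow> regular \<and> (\<forall>r s. equivalence_relation r s \<longrightarrow> (\<exists>f. kernel_pair f r s))"


subsection \<open>Points and Bourn protomodularity\<close>

definition point :: "'o \<Rightarrow> 'm \<Rightarrow> 'm \<Rightarrow> bool" where
  "point B p s \<longleftrightarrow> p \<in> hom (Dom C p) B \<and> s \<in> hom B (Dom C p) \<and> p \<cdot> s = Id C B"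

definition point_morphism :: "'o \<Rightarrow> 'm \<Rightarrow> 'm \<Rightarrow> 'm \<Rightarrow> 'm \<Rightarrow> 'm \<Rightarrow> bool" where
  "point_morphism B p s p' s' f \<longleftrightarrow> point B p s \<and> point B p' s' \<and>
    f \<in> hom (Dom C p) (Dom C p') \<and> p' \<cdot> f = p \<and> f \<cdot> s = s'"

text \<open>Every change-of-base functor between categories of points, along \<open>v : E \<rightarrow> B\<close>, reflects
  isomorphisms. The arrow \<open>g\<close> below is the image of \<open>f\<close> under this functor; it automatically commutes
  with the induced sections of \<open>r\<close> and \<open>r'\<close>, and a morphism of points is invertible in the category
  of points iff it is invertible in the underlying category.\<close>

definition protomodular :: bool where
  "protomodular \<longleftrightarrow>
    (\<forall>B p s p' s' f v q r q' r' g.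
      point_morphism B p s p' s' f \<and> pullback p v q r \<and> pullback p' v q' r' \<and>
      g \<in> hom (Dom C q) (Dom C q') \<and> q' \<cdot> g = f \<cdot> q \<and> r' \<cdot> g = r \<and> iso g
      \<longrightarrow> iso f)"


subsection \<open>Zero arrows, kernels, chosen products and coproducts\<close>

definition zero :: "'o \<Rightarrow> 'o \<Rightarrow> 'm" where
  "zero X Y = (THE f. \<exists>Z. zero_object Z \<and> (\<exists>u \<in> hom X Z. \<exists>v \<in> hom Z Y. f = v \<cdot> u))"

definition kernel :: "'m \<Rightarrow> 'm \<Rightarrow> bool" where
  "kernel f k \<longleftrightarrow> equalizer f (zero (Dom C f) (Cod C f)) k"

definition ker :: "'m \<Rightarrow> 'm" where
  "ker f = (SOME k. kernel f k)"

definition chosen_product :: "'o \<Rightarrow> 'o \<Rightarrow> 'm \<times> 'm" where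
  "chosen_product X Y = (SOME pq. product X Y (fst pq) (snd pq))"

definition proj1 :: "'o \<Rightarrow> 'o \<Rightarrow> 'm" where
  "proj1 X Y = fst (chosen_product X Y)"

definition proj2 :: "'o \<Rightarrow> 'o \<Rightarrow> 'm" where
  "proj2 X Y = snd (chosen_product X Y)"

definition prod :: "'o \<Rightarrow> 'o \<Rightarrow> 'o" where
  "prod X Y = Dom C (proj1 X Y)"

definition pair :: "'m \<Rightarrow> 'm \<Rightarrow> 'm" where
  "pair f g = (THE u. u \<in> hom (Dom C f) (prod (Cod C f) (Cod C g)) \<and>
    proj1 (Cod C f) (Cod C g) \<cdot> u = f \<and> proj2 (Cod C f) (Cod C g) \<cdot> u = g)"

definition chosen_coproduct :: "'o \<Rightarrow> 'o \<Rightarrow> 'm \<times> 'm" where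
  "chosen_coproduct X Y = (SOME ij. coproduct X Y (fst ij) (snd ij))"

definition inj1 :: "'o \<Rightarrow> 'o \<Rightarrow> 'm" where
  "inj1 X Y = fst (chosen_coproduct X Y)"

definition inj2 :: "'o \<Rightarrow> 'o \<Rightarrow> 'm" where
  "inj2 X Y = snd (chosen_coproduct X Y)"

definition coprod :: "'o \<Rightarrow> 'o \<Rightarrow> 'o" where
  "coprod X Y = Cod C (inj1 X Y)"

definition copair :: "'m \<Rightarrow> 'm \<Rightarrow> 'm" where
  "copair f g = (THE u. u \<in> hom (coprod (Dom C f) (Dom C g)) (Cod C f) \<and>
    u \<cdot> inj1 (Dom C f) (Dom C g) = f \<and> u \<cdot> inj2 (Dom C f) (Dom C g) = g)"


subsection \<open>Internal actions\<close>

text \<open>The functor \<open>Ker\<^sub>B\<close> on a morphism \<open>f : (p, s) \<rightarrow> (p', s')\<close> of points; the sections play no role.\<close>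

definition ker_map :: "'m \<Rightarrow> 'm \<Rightarrow> 'm \<Rightarrow> 'm" where
  "ker_map p p' f = (THE u. u \<in> hom (Dom C (ker p)) (Dom C (ker p')) \<and> ker p' \<cdot> u = f \<cdot> ker p)"

text \<open>The left adjoint sends \<open>X\<close> to the point \<open>(B + X, retraction B X, inj1 B X)\<close> and \<open>f\<close> to
  \<open>sum_map B f = 1 + f\<close>.\<close>

definition retraction :: "'o \<Rightarrow> 'o \<Rightarrow> 'm" where
  "retraction B X = copair (Id C B) (zero X B)"

definition sum_map :: "'o \<Rightarrow> 'm \<Rightarrow> 'm" where
  "sum_map B f = copair (inj1 B (Cod C f)) (inj2 B (Cod C f) \<cdot> f)"

text \<open>The counit of the adjunction at the point \<open>(p, s)\<close>, with domain \<open>B + Ker p\<close>.\<close>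

definition counit :: "'m \<Rightarrow> 'm \<Rightarrow> 'm" where
  "counit p s = copair s (ker p)"

definition flat :: "'o \<Rightarrow> 'o \<Rightarrow> 'o" where
  "flat B X = Dom C (ker (retraction B X))"

definition flat_map :: "'o \<Rightarrow> 'm \<Rightarrow> 'm" where
  "flat_map B f = ker_map (retraction B (Dom C f)) (retraction B (Cod C f)) (sum_map B f)"

text \<open>The unit at \<open>X\<close> is the adjoint transpose of the identity of \<open>(B + X, retraction B X, inj1 B X)\<close>,
  and the multiplication is \<open>Ker\<^sub>B\<close> applied to the counit at this point.\<close>

definition flat_unit :: "'o \<Rightarrow> 'o \<Rightarrow> 'm" where
  "flat_unit B X = (THE u. u \<in> hom X (flat B X) \<and> ker (retraction B X) \<cdot> u = inj2 B X)"

definition flat_mult :: "'o \<Rightarrow> 'o \<Rightarrow> 'm" where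
  "flat_mult B X = ker_map (retraction B (flat B X)) (retraction B X)
    (counit (retraction B X) (inj1 B X))"

definition action :: "'o \<Rightarrow> 'o \<Rightarrow> 'm \<Rightarrow> bool" where
  "action B X \<xi> \<longleftrightarrow> B \<in> Obj C \<and> X \<in> Obj C \<and> \<xi> \<in> hom (flat B X) X \<and>
    \<xi> \<cdot> flat_unit B X = Id C X \<and> \<xi> \<cdot> flat_mult B X = \<xi> \<cdot> flat_map B \<xi>"


subsection \<open>Subobjects, commutators and centralisers\<close>

text \<open>A subobject is represented by a monomorphism; \<open>sub_le k z\<close> is the order of subobjects.\<close>

definition subobject :: "'m \<Rightarrow> 'o \<Rightarrow> bool" where
  "subobject h G \<longleftrightarrow> monic h \<and> Cod C h = G"

definition sub_le :: "'m \<Rightarrow> 'm \<Rightarrow> bool" where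
  "sub_le k z \<longleftrightarrow> (\<exists>u \<in> hom (Dom C k) (Dom C z). z \<cdot> u = k)"

definition normal_subobject :: "'m \<Rightarrow> 'o \<Rightarrow> bool" where
  "normal_subobject h G \<longleftrightarrow> subobject h G \<and> (\<exists>f. kernel f h)"

definition characteristic :: "'m \<Rightarrow> 'o \<Rightarrow> bool" where
  "characteristic h G \<longleftrightarrow> subobject h G \<and>
    (\<forall>B \<xi>. action B G \<xi> \<longrightarrow> (\<exists>!\<xi>'. action B (Dom C h) \<xi>' \<and> h \<cdot> \<xi>' = \<xi> \<cdot> flat_map B h))"

definition Sigma_map :: "'o \<Rightarrow> 'o \<Rightarrow> 'm" where
  "Sigma_map H K = pair (copair (Id C H) (zero K H)) (copair (zero H K) (Id C K))"

text \<open>\<open>huq_commutator h k c\<close>: the arrow \<open>c\<close> represents the subobject \<open>[H, K]\<^sub>G\<close>, which is determined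
  up to isomorphism only.\<close>

definition huq_commutator :: "'m \<Rightarrow> 'm \<Rightarrow> 'm \<Rightarrow> bool" where
  "huq_commutator h k c \<longleftrightarrow>
    (\<exists>w \<pi>. pushout (Sigma_map (Dom C h) (Dom C k)) (copair h k) w \<pi> \<and> kernel \<pi> c)"

definition huq_commutator_zero :: "'m \<Rightarrow> 'm \<Rightarrow> bool" where
  "huq_commutator_zero h k \<longleftrightarrow> (\<exists>c. huq_commutator h k c \<and> zero_object (Dom C c))"

definition centraliser :: "'m \<Rightarrow> 'o \<Rightarrow> 'm \<Rightarrow> bool" where
  "centraliser h G z \<longleftrightarrow> subobject h G \<and> subobject z G \<and> huq_commutator_zero h z \<and>
    (\<forall>k. subobject k G \<and> huq_commutator_zero h k \<longrightarrow> sub_le k z)"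

end

locale semi_abelian = category C for C :: "('o, 'm) cat_data" +
  assumes pointed: pointed
    and has_finite_coproducts: has_finite_coproducts
    and barr_exact: barr_exact
    and protomodular: protomodular

end

theory Submission
  imports Defs
begin

text \<open>Normality can be read off from conjugation: a monomorphism \<open>m : H \<rightarrow> A\<close> is a kernel as soon as
  \<open>[1, m] \<kappa> : A\<flat>H \<rightarrow> A\<close> factors through \<open>m\<close>, where \<open>\<kappa> : A\<flat>H \<rightarrow> A + H\<close> is the inclusion.
  Hence, if \<open>G\<close> is the kernel of an arrow from \<open>A\<close> and \<open>H\<close>
  is characteristic in \<open>G\<close>, then \<open>H\<close>, being stable under the conjugation action of \<open>A\<close> on \<open>G\<close>, is
  normal in \<open>A\<close>. Taking \<open>A = G\<close> gives the centraliser. Given an action \<open>\<xi>\<close> of \<open>B\<close> on \<open>G\<close>, take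
  for \<open>A\<close> the semidirect product: the centraliser of \<open>H\<close> in \<open>A\<close> is normal in \<open>A\<close>, and its intersection
  with \<open>G\<close> is \<open>Z\<^sub>G(H)\<close>, which is therefore normal in \<open>A\<close>. So \<open>\<xi>\<close>, which is conjugation in \<open>A\<close>
  along \<open>B \<rightarrow> A\<close>, restricts to it.\<close>

subsection \<open>Categories\<close>

text \<open>There are no elements to compute with, so exactness is used through generalised ones: an
  element lifts along a regular epimorphism after passing to a cover, and membership in a subobject
  may be checked on a cover. Protomodularity is given only as reflection of isomorphisms by change
  of base. It enters directly at two places: a subobject of a pullback of points that contains both
  canonical sections is everything, and an arrow with zero kernel is monic. The former yields the
  Mal'tsev property, which makes coequalisers of reflexive pairs computable, and the fact that
  arrows out of a product are determined on its two factors. Both explicit quotients, the one that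
  exhibits a conjugation-stable subobject as a kernel and the semidirect product, are coequalisers
  of reflexive pairs. The Huq commutator is a pushout formed in a fixed ambient object, whereas
  comparing centralisers in \<open>G\<close> and in \<open>A\<close> changes that object. Its
  triviality is therefore traded for a cooperator on \<open>H \<times> K\<close>, which can be
  carried from \<open>G\<close> to \<open>A\<close> and back.\<close>

context category
begin

lemma mem_hom_iff [simp]: "f \<in> hom X Y \<longleftrightarrow> f \<in> Arr C \<and> Dom C f = X \<and> Cod C f = Y"
  by (simp add: hom_def)

declare Id_Arr [simp] Dom_Id [simp] Cod_Id [simp] Comp_Arr [simp] Dom_Comp [simp] Cod_Comp [simp]
  Dom_Obj [simp] Cod_Obj [simp]

lemma comp_Id_right [simp]: "\<lbrakk>f \<in> Arr C; Dom C f = X\<rbrakk> \<Longrightarrow> f \<cdot> Id C X = f"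
  using Comp_Id by blast

lemma comp_Id_left [simp]: "\<lbrakk>f \<in> Arr C; Cod C f = X\<rbrakk> \<Longrightarrow> Id C X \<cdot> f = f"
  using Id_Comp by blast

lemma comp_assoc [simp]:
  "\<lbrakk>f \<in> Arr C; g \<in> Arr C; h \<in> Arr C; Cod C f = Dom C g; Cod C g = Dom C h\<rbrakk>
    \<Longrightarrow> (h \<cdot> g) \<cdot> f = h \<cdot> (g \<cdot> f)"
  using Comp_assoc by simp

text \<open>\<open>comp_assoc\<close> nests every composite to the right, which hides the left-hand
  side of an equation \<open>g \<cdot> f = k\<close> once a further arrow is composed on the right.
  Instances of this form restore the rewrite inside longer composites.\<close>

lemma comp_reduce:
  "\<lbrakk>g \<cdot> f = k; f \<in> Arr C; g \<in> Arr C; Cod C f = Dom C g; x \<in> Arr C; Cod C x = Dom C f\<rbrakk>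
    \<Longrightarrow> g \<cdot> (f \<cdot> x) = k \<cdot> x"
  using comp_assoc[of x f g] by simp

lemma hom_Obj: "f \<in> hom X Y \<Longrightarrow> X \<in> Obj C \<and> Y \<in> Obj C"
  by auto

lemma monic_Arr: "monic m \<Longrightarrow> m \<in> Arr C"
  by (simp add: monic_def)

lemma monic_cancel:
  "\<lbrakk>monic m; u \<in> hom W (Dom C m); v \<in> hom W (Dom C m); m \<cdot> u = m \<cdot> v\<rbrakk> \<Longrightarrow> u = v"
  unfolding monic_def by blast

lemma monic_comp:
  assumes "monic m" "monic n" "Cod C m = Dom C n"
  shows "monic (n \<cdot> m)"
  unfolding monic_def
proof (intro conjI allI ballI impI)
  note [simp] = monic_Arr[OF assms(1)] monic_Arr[OF assms(2)] assms(3)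
  show "n \<cdot> m \<in> Arr C" by simp
  fix W u v assume u: "u \<in> hom W (Dom C (n \<cdot> m))" and v: "v \<in> hom W (Dom C (n \<cdot> m))"
    and eq: "(n \<cdot> m) \<cdot> u = (n \<cdot> m) \<cdot> v"
  have "m \<cdot> u = m \<cdot> v"
    using monic_cancel[OF assms(2), of "m \<cdot> u" W "m \<cdot> v"] u v eq by simp
  then show "u = v" using monic_cancel[OF assms(1)] u v by simp
qed

lemma iso_Id: "X \<in> Obj C \<Longrightarrow> iso (Id C X)"
  by (auto simp: iso_def intro!: bexI[of _ "Id C X"])

section \<open>Pullbacks\<close>

lemma pullback_hom:
  assumes "pullback f g p q"
  shows "f \<in> Arr C" "g \<in> Arr C" "Cod C g = Cod C f" "p \<in> Arr C" "Cod C p = Dom C f"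
    "q \<in> Arr C" "Dom C q = Dom C p" "Cod C q = Dom C g" "f \<cdot> p = g \<cdot> q"
  using assms by (auto simp: pullback_def)

lemma pullback_lift:
  assumes "pullback f g p q" "a \<in> hom W (Dom C f)" "b \<in> hom W (Dom C g)" "f \<cdot> a = g \<cdot> b"
  obtains u where "u \<in> hom W (Dom C p)" "p \<cdot> u = a" "q \<cdot> u = b"
  using assms unfolding pullback_def by blast

lemma pullback_eqI:
  assumes "pullback f g p q" "u \<in> hom W (Dom C p)" "v \<in> hom W (Dom C p)"
    "p \<cdot> u = p \<cdot> v" "q \<cdot> u = q \<cdot> v"
  shows "u = v"
proof -
  note [simp] = pullback_hom[OF assms(1)]
  have "f \<cdot> (p \<cdot> v) = g \<cdot> (q \<cdot> v)"
    using assms(3) comp_reduce[OF pullback_hom(9)[OF assms(1)], of v] by simp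
  then have "\<exists>!w. w \<in> hom W (Dom C p) \<and> p \<cdot> w = p \<cdot> v \<and> q \<cdot> w = q \<cdot> v"
    using assms(1,3) unfolding pullback_def by auto
  then show ?thesis using assms by blast
qed

lemma pullbackI:
  assumes "f \<in> Arr C" "g \<in> Arr C" "Cod C f = Cod C g"
    "p \<in> hom (Dom C p) (Dom C f)" "q \<in> hom (Dom C p) (Dom C g)" "f \<cdot> p = g \<cdot> q"
    "\<And>W a b. \<lbrakk>a \<in> hom W (Dom C f); b \<in> hom W (Dom C g); f \<cdot> a = g \<cdot> b\<rbrakk>
      \<Longrightarrow> \<exists>u \<in> hom W (Dom C p). p \<cdot> u = a \<and> q \<cdot> u = b"
    "\<And>W u v. \<lbrakk>u \<in> hom W (Dom C p); v \<in> hom W (Dom C p); p \<cdot> u = p \<cdot> v; q \<cdot> u = q \<cdot> v\<rbrakk>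
      \<Longrightarrow> u = v"
  shows "pullback f g p q"
  unfolding pullback_def
proof (intro conjI allI ballI impI)
  fix W a b assume "a \<in> hom W (Dom C f)" "b \<in> hom W (Dom C g)" "f \<cdot> a = g \<cdot> b"
  then obtain u where u: "u \<in> hom W (Dom C p)" "p \<cdot> u = a" "q \<cdot> u = b"
    using assms(7) by blast
  show "\<exists>!u. u \<in> hom W (Dom C p) \<and> p \<cdot> u = a \<and> q \<cdot> u = b"
  proof (rule ex1I[of _ u])
    show "v = u" if "v \<in> hom W (Dom C p) \<and> p \<cdot> v = a \<and> q \<cdot> v = b" for v
      by (rule assms(8)) (use that u in simp_all)
  qed (use u in blast)
qed (rule assms(1-6))+

lemma pullback_monic:
  assumes "pullback f m p q" "monic m"
  shows "monic p"
  unfolding monic_def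
proof (intro conjI allI ballI impI)
  note [simp] = pullback_hom[OF assms(1)]
  show "p \<in> Arr C" by simp
  fix W u v assume u: "u \<in> hom W (Dom C p)" and v: "v \<in> hom W (Dom C p)" and eq: "p \<cdot> u = p \<cdot> v"
  have "m \<cdot> (q \<cdot> u) = m \<cdot> (q \<cdot> v)"
    using u v eq comp_reduce[OF pullback_hom(9)[OF assms(1)], of u]
      comp_reduce[OF pullback_hom(9)[OF assms(1)], of v] by simp
  then have "q \<cdot> u = q \<cdot> v"
    using monic_cancel[OF assms(2), of "q \<cdot> u" W "q \<cdot> v"] u v by simp
  then show "u = v" using pullback_eqI[OF assms(1)] u v eq by blast
qed

section \<open>Regular epimorphisms\<close>

lemma coequalizer_factor:
  assumes "coequalizer f g q" "a \<in> hom (Cod C f) W" "a \<cdot> f = a \<cdot> g"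
  obtains u where "u \<in> hom (Cod C q) W" "u \<cdot> q = a"
  using assms unfolding coequalizer_def by blast

lemma regular_epi_Arr:
  assumes "regular_epi e"
  shows "e \<in> Arr C"
  using assms unfolding regular_epi_def coequalizer_def by auto

lemma regular_epi_cancel:
  assumes "regular_epi e" "u \<in> hom (Cod C e) W" "v \<in> hom (Cod C e) W" "u \<cdot> e = v \<cdot> e"
  shows "u = v"
proof -
  obtain f g where fg: "coequalizer f g e" using assms(1) unfolding regular_epi_def by blast
  then have [simp]: "f \<in> Arr C" "g \<in> Arr C" "Cod C g = Cod C f" "Dom C g = Dom C f"
    "e \<in> Arr C" "Dom C e = Cod C f" and "e \<cdot> f = e \<cdot> g"
    by (auto simp: coequalizer_def parallel_def)
  then have "(v \<cdot> e) \<cdot> f = (v \<cdot> e) \<cdot> g" using assms by simp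
  moreover have "v \<cdot> e \<in> hom (Cod C f) W" using assms by simp
  ultimately have "\<exists>!w. w \<in> hom (Cod C e) W \<and> w \<cdot> e = v \<cdot> e"
    using fg unfolding coequalizer_def by blast
  then show ?thesis using assms by blast
qed

text \<open>Belonging to a subobject is local for covers. If \<open>e\<close> is the coequaliser of
  \<open>f\<close> and \<open>g\<close>, then \<open>b\<close> coequalises them too, because
  \<open>m \<cdot> b\<close> does and \<open>m\<close> is monic; the arrow induced by
  \<open>b\<close> is the factorisation.\<close>

lemma regular_epi_monic_factor:
  assumes "regular_epi e" "monic m" "a \<in> hom (Cod C e) (Cod C m)" "b \<in> hom (Dom C e) (Dom C m)"
    "a \<cdot> e = m \<cdot> b"
  obtains t where "t \<in> hom (Cod C e) (Dom C m)" "m \<cdot> t = a"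
proof -
  obtain f g where fg: "coequalizer f g e" using assms(1) unfolding regular_epi_def by blast
  then have [simp]: "f \<in> Arr C" "g \<in> Arr C" "Cod C g = Cod C f" "Dom C g = Dom C f"
    "e \<in> Arr C" "Dom C e = Cod C f" and ef: "e \<cdot> f = e \<cdot> g"
    by (auto simp: coequalizer_def parallel_def)
  note [simp] = monic_Arr[OF assms(2)]
  have "m \<cdot> (b \<cdot> f) = a \<cdot> (e \<cdot> f)" using comp_reduce[OF assms(5), of f] assms by simp
  also have "\<dots> = m \<cdot> (b \<cdot> g)" using comp_reduce[OF assms(5), of g] assms ef by simp
  finally have "b \<cdot> f = b \<cdot> g"
    using monic_cancel[OF assms(2), of "b \<cdot> f" "Dom C f" "b \<cdot> g"] assms by simp
  moreover have "b \<in> hom (Cod C f) (Dom C m)" using assms by simp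
  ultimately obtain t where t: "t \<in> hom (Cod C e) (Dom C m)" "t \<cdot> e = b"
    using coequalizer_factor[OF fg] by blast
  have "m \<cdot> t = a"
    using regular_epi_cancel[OF assms(1), of "m \<cdot> t" "Cod C m" a] t assms by simp
  with t that show thesis by blast
qed

end

subsection \<open>Limits, coproducts and kernels\<close>

context semi_abelian
begin

lemma finitely_complete: finitely_complete
  and kernel_pair_coequalizer: "kernel_pair f r s \<Longrightarrow> \<exists>q. coequalizer r s q"
  and regular_epi_pullback: "\<lbrakk>pullback f g p q; regular_epi f\<rbrakk> \<Longrightarrow> regular_epi q"
  and equivalence_relation_effective: "equivalence_relation r s \<Longrightarrow> \<exists>f. kernel_pair f r s"
  using barr_exact unfolding barr_exact_def regular_def by blast+

section \<open>Binary products and coproducts\<close>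

lemma chosen_product:
  assumes "X \<in> Obj C" "Y \<in> Obj C"
  shows "product X Y (proj1 X Y) (proj2 X Y)"
proof -
  have "\<exists>pq. product X Y (fst pq) (snd pq)"
    using finitely_complete assms unfolding finitely_complete_def by auto
  then show ?thesis
    unfolding proj1_def proj2_def chosen_product_def by (rule someI_ex)
qed

lemma proj_hom [simp]:
  assumes "X \<in> Obj C" "Y \<in> Obj C"
  shows "proj1 X Y \<in> Arr C" "Dom C (proj1 X Y) = prod X Y" "Cod C (proj1 X Y) = X"
    "proj2 X Y \<in> Arr C" "Dom C (proj2 X Y) = prod X Y" "Cod C (proj2 X Y) = Y" "prod X Y \<in> Obj C"
  using chosen_product[OF assms] unfolding product_def prod_def by auto

lemma pair_props:
  assumes "f \<in> hom W X" "g \<in> hom W Y"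
  shows "pair f g \<in> hom W (prod X Y) \<and> proj1 X Y \<cdot> pair f g = f \<and> proj2 X Y \<cdot> pair f g = g"
proof -
  have XY: "X \<in> Obj C" "Y \<in> Obj C" using assms by auto
  have "\<exists>!u. u \<in> hom W (prod X Y) \<and> proj1 X Y \<cdot> u = f \<and> proj2 X Y \<cdot> u = g"
    using chosen_product[OF XY] assms unfolding product_def prod_def by blast
  from theI'[OF this] show ?thesis using assms unfolding pair_def by simp
qed

lemma pair_hom [simp]:
  assumes "f \<in> Arr C" "g \<in> Arr C" "Dom C f = Dom C g"
  shows "pair f g \<in> Arr C" "Dom C (pair f g) = Dom C g" "Cod C (pair f g) = prod (Cod C f) (Cod C g)"
  using pair_props[of f "Dom C g" "Cod C f" g "Cod C g"] assms by auto

lemma proj_pair [simp]: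
  assumes "f \<in> Arr C" "g \<in> Arr C" "Dom C f = Dom C g" "Cod C f = X" "Cod C g = Y"
  shows "proj1 X Y \<cdot> pair f g = f" "proj2 X Y \<cdot> pair f g = g"
  using pair_props[of f "Dom C g" X g Y] assms by auto

lemma prod_eqI:
  assumes "X \<in> Obj C" "Y \<in> Obj C" "u \<in> hom W (prod X Y)" "v \<in> hom W (prod X Y)"
    "proj1 X Y \<cdot> u = proj1 X Y \<cdot> v" "proj2 X Y \<cdot> u = proj2 X Y \<cdot> v"
  shows "u = v"
proof -
  have "proj1 X Y \<cdot> v \<in> hom W X" "proj2 X Y \<cdot> v \<in> hom W Y" using assms by auto
  then have "\<exists>!w. w \<in> hom W (prod X Y) \<and> proj1 X Y \<cdot> w = proj1 X Y \<cdot> v \<and> proj2 X Y \<cdot> w = proj2 X Y \<cdot> v"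
    using chosen_product[OF assms(1,2)] unfolding product_def prod_def by blast
  then show ?thesis using assms by blast
qed

lemma chosen_coproduct:
  assumes "X \<in> Obj C" "Y \<in> Obj C"
  shows "coproduct X Y (inj1 X Y) (inj2 X Y)"
proof -
  have "\<exists>ij. coproduct X Y (fst ij) (snd ij)"
    using has_finite_coproducts assms unfolding has_finite_coproducts_def by auto
  then show ?thesis
    unfolding inj1_def inj2_def chosen_coproduct_def by (rule someI_ex)
qed

lemma inj_hom [simp]:
  assumes "X \<in> Obj C" "Y \<in> Obj C"
  shows "inj1 X Y \<in> Arr C" "Dom C (inj1 X Y) = X" "Cod C (inj1 X Y) = coprod X Y"
    "inj2 X Y \<in> Arr C" "Dom C (inj2 X Y) = Y" "Cod C (inj2 X Y) = coprod X Y" "coprod X Y \<in> Obj C"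
  using chosen_coproduct[OF assms] unfolding coproduct_def coprod_def by auto

lemma copair_props:
  assumes "f \<in> hom X W" "g \<in> hom Y W"
  shows "copair f g \<in> hom (coprod X Y) W \<and> copair f g \<cdot> inj1 X Y = f \<and> copair f g \<cdot> inj2 X Y = g"
proof -
  have XY: "X \<in> Obj C" "Y \<in> Obj C" using assms by auto
  have "\<exists>!u. u \<in> hom (coprod X Y) W \<and> u \<cdot> inj1 X Y = f \<and> u \<cdot> inj2 X Y = g"
    using chosen_coproduct[OF XY] assms unfolding coproduct_def coprod_def by blast
  from theI'[OF this] show ?thesis using assms unfolding copair_def by simp
qed

lemma copair_hom [simp]:
  assumes "f \<in> Arr C" "g \<in> Arr C" "Cod C f = Cod C g"
  shows "copair f g \<in> Arr C" "Dom C (copair f g) = coprod (Dom C f) (Dom C g)"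
    "Cod C (copair f g) = Cod C g"
  using copair_props[of f "Dom C f" "Cod C g" g "Dom C g"] assms by auto

lemma copair_inj [simp]:
  assumes "f \<in> Arr C" "g \<in> Arr C" "Cod C f = Cod C g" "Dom C f = X" "Dom C g = Y"
  shows "copair f g \<cdot> inj1 X Y = f" "copair f g \<cdot> inj2 X Y = g"
  using copair_props[of f X "Cod C g" g Y] assms by auto

lemma coprod_eqI:
  assumes "X \<in> Obj C" "Y \<in> Obj C" "u \<in> hom (coprod X Y) W" "v \<in> hom (coprod X Y) W"
    "u \<cdot> inj1 X Y = v \<cdot> inj1 X Y" "u \<cdot> inj2 X Y = v \<cdot> inj2 X Y"
  shows "u = v"
proof -
  have "v \<cdot> inj1 X Y \<in> hom X W" "v \<cdot> inj2 X Y \<in> hom Y W" using assms by auto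
  then have "\<exists>!w. w \<in> hom (coprod X Y) W \<and> w \<cdot> inj1 X Y = v \<cdot> inj1 X Y \<and> w \<cdot> inj2 X Y = v \<cdot> inj2 X Y"
    using chosen_coproduct[OF assms(1,2)] unfolding coproduct_def coprod_def by blast
  then show ?thesis using assms by blast
qed

lemma comp_copair:
  assumes "f \<in> Arr C" "g \<in> Arr C" "Cod C f = Cod C g" "t \<in> Arr C" "Dom C t = Cod C g"
  shows "t \<cdot> copair f g = copair (t \<cdot> f) (t \<cdot> g)"
  by (rule coprod_eqI[of "Dom C f" "Dom C g" _ "Cod C t"]) (use assms in simp_all)

section \<open>Zero arrows\<close>

lemma zero_object_arrow_unique:
  assumes "zero_object Z"
  shows "\<lbrakk>u \<in> hom X Z; v \<in> hom X Z\<rbrakk> \<Longrightarrow> u = v" "\<lbrakk>u \<in> hom Z X; v \<in> hom Z X\<rbrakk> \<Longrightarrow> u = v"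
proof -
  assume uv: "u \<in> hom X Z" "v \<in> hom X Z"
  then have "X \<in> Obj C" by auto
  then show "u = v" using uv assms unfolding zero_object_def terminal_object_def by blast
next
  assume uv: "u \<in> hom Z X" "v \<in> hom Z X"
  then have "X \<in> Obj C" by auto
  then show "u = v" using uv assms unfolding zero_object_def initial_object_def by blast
qed

lemma zero_object_Obj: "zero_object Z \<Longrightarrow> Z \<in> Obj C"
  unfolding zero_object_def initial_object_def by blast

lemma zero_object_arrow:
  assumes "zero_object Z" "X \<in> Obj C"
  obtains u v where "u \<in> hom X Z" "v \<in> hom Z X"
  using assms unfolding zero_object_def initial_object_def terminal_object_def by blast

text \<open>The definite description in \<open>zero\<close> ranges over all zero objects; this makes
  the choice immaterial. An arrow \<open>t\<close> between two zero objects turns one factorisation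
  into the other.\<close>

lemma zero_factor_unique:
  assumes "zero_object Z" "zero_object Z'" "u \<in> hom X Z" "v \<in> hom Z Y" "u' \<in> hom X Z'" "v' \<in> hom Z' Y"
  shows "v \<cdot> u = v' \<cdot> u'"
proof -
  obtain t where t: "t \<in> hom Z Z'"
    using zero_object_arrow[OF assms(2) zero_object_Obj[OF assms(1)]] by blast
  have "u' = t \<cdot> u" by (rule zero_object_arrow_unique(1)[OF assms(2)]) (use assms t in auto)
  moreover have "v = v' \<cdot> t" by (rule zero_object_arrow_unique(2)[OF assms(1)]) (use assms t in auto)
  ultimately show ?thesis using assms t by auto
qed

lemma zero_eqI:
  assumes "zero_object Z" "u \<in> hom X Z" "v \<in> hom Z Y"
  shows "zero X Y = v \<cdot> u"
  unfolding zero_def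
proof (rule the_equality)
  show "\<exists>Z. zero_object Z \<and> (\<exists>u'\<in>hom X Z. \<exists>v'\<in>hom Z Y. v \<cdot> u = v' \<cdot> u')"
    using assms by blast
  show "f = v \<cdot> u" if "\<exists>Z. zero_object Z \<and> (\<exists>u\<in>hom X Z. \<exists>v\<in>hom Z Y. f = v \<cdot> u)" for f
    using that zero_factor_unique[OF _ assms(1) _ _ assms(2,3)] by blast
qed

lemma zero_factors:
  assumes "X \<in> Obj C" "Y \<in> Obj C"
  obtains Z u v where "zero_object Z" "u \<in> hom X Z" "v \<in> hom Z Y" "zero X Y = v \<cdot> u"
proof -
  obtain Z where Z: "zero_object Z" using pointed unfolding pointed_def by blast
  obtain u v where "u \<in> hom X Z" "v \<in> hom Z Y"
    using zero_object_arrow[OF Z assms(1)] zero_object_arrow[OF Z assms(2)] by metis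
  then show thesis using that Z zero_eqI by blast
qed

lemma zero_hom [simp]:
  assumes "X \<in> Obj C" "Y \<in> Obj C"
  shows "zero X Y \<in> Arr C" "Dom C (zero X Y) = X" "Cod C (zero X Y) = Y"
  by (rule zero_factors[OF assms], simp)+

lemma zero_comp [simp]:
  assumes "f \<in> Arr C" "Cod C f = X" "Y \<in> Obj C"
  shows "zero X Y \<cdot> f = zero (Dom C f) Y"
proof -
  have "X \<in> Obj C" using assms by auto
  then obtain Z u v where *: "zero_object Z" "u \<in> hom X Z" "v \<in> hom Z Y" "zero X Y = v \<cdot> u"
    using assms(3) by (rule zero_factors)
  then have "zero (Dom C f) Y = v \<cdot> (u \<cdot> f)" using assms by (intro zero_eqI[of Z]) auto
  then show ?thesis using * assms by auto
qed

lemma comp_zero [simp]: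
  assumes "f \<in> Arr C" "Dom C f = Y" "X \<in> Obj C"
  shows "f \<cdot> zero X Y = zero X (Cod C f)"
proof -
  have "Y \<in> Obj C" using assms by auto
  with assms(3) obtain Z u v where *: "zero_object Z" "u \<in> hom X Z" "v \<in> hom Z Y" "zero X Y = v \<cdot> u"
    by (rule zero_factors)
  then have "zero X (Cod C f) = (f \<cdot> v) \<cdot> u" using assms by (intro zero_eqI[of Z]) auto
  then show ?thesis using * assms by auto
qed

lemma arrow_to_zero_object: "\<lbrakk>zero_object Z; f \<in> hom X Z\<rbrakk> \<Longrightarrow> f = zero X Z"
  by (rule zero_object_arrow_unique(1)) auto

section \<open>Existence of pullbacks, and kernels\<close>

lemma pullback_exists:
  assumes "f \<in> Arr C" "g \<in> Arr C" "Cod C f = Cod C g"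
  obtains p q where "pullback f g p q"
proof -
  let ?X = "Dom C f" and ?Y = "Dom C g"
  note [simp] = assms
  let ?a = "f \<cdot> proj1 ?X ?Y" and ?b = "g \<cdot> proj2 ?X ?Y"
  have "parallel ?a ?b" by (simp add: parallel_def)
  then obtain e where e: "equalizer ?a ?b e"
    using finitely_complete unfolding finitely_complete_def by blast
  then have [simp]: "e \<in> Arr C" "Cod C e = prod ?X ?Y" and eq: "?a \<cdot> e = ?b \<cdot> e"
    by (auto simp: equalizer_def)
  have "pullback f g (proj1 ?X ?Y \<cdot> e) (proj2 ?X ?Y \<cdot> e)"
  proof (rule pullbackI)
    fix W a b assume a: "a \<in> hom W ?X" and b: "b \<in> hom W ?Y" and fg: "f \<cdot> a = g \<cdot> b"
    have "?a \<cdot> pair a b = ?b \<cdot> pair a b" using a b fg by simp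
    moreover have "pair a b \<in> hom W (Dom C ?a)" using a b by simp
    ultimately obtain u where u: "u \<in> hom W (Dom C e)" "e \<cdot> u = pair a b"
      using e unfolding equalizer_def by blast
    then show "\<exists>u\<in>hom W (Dom C (proj1 ?X ?Y \<cdot> e)).
        (proj1 ?X ?Y \<cdot> e) \<cdot> u = a \<and> (proj2 ?X ?Y \<cdot> e) \<cdot> u = b"
      using a b by (intro bexI[of _ u]) auto
  next
    fix W u v assume u: "u \<in> hom W (Dom C (proj1 ?X ?Y \<cdot> e))" and v: "v \<in> hom W (Dom C (proj1 ?X ?Y \<cdot> e))"
      and eqs: "(proj1 ?X ?Y \<cdot> e) \<cdot> u = (proj1 ?X ?Y \<cdot> e) \<cdot> v" "(proj2 ?X ?Y \<cdot> e) \<cdot> u = (proj2 ?X ?Y \<cdot> e) \<cdot> v"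
    have uv: "e \<cdot> u = e \<cdot> v" by (rule prod_eqI[of ?X ?Y _ W]) (use u v eqs in simp_all)
    have "?a \<cdot> (e \<cdot> v) = ?b \<cdot> (e \<cdot> v)"
      using comp_reduce[OF eq, of v] v by simp
    moreover have "e \<cdot> v \<in> hom W (Dom C ?a)" using v by simp
    ultimately have "\<exists>!w. w \<in> hom W (Dom C e) \<and> e \<cdot> w = e \<cdot> v"
      using e unfolding equalizer_def by blast
    then show "u = v" using u v uv by auto
  qed (use eq in simp_all)
  with that show thesis .
qed

lemma kernel_hom:
  assumes "kernel f k"
  shows "f \<in> Arr C" "k \<in> Arr C" "Cod C k = Dom C f" "f \<cdot> k = zero (Dom C k) (Cod C f)"
proof -
  show *: "f \<in> Arr C" "k \<in> Arr C" "Cod C k = Dom C f"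
    using assms by (auto simp: kernel_def equalizer_def parallel_def)
  then show "f \<cdot> k = zero (Dom C k) (Cod C f)"
    using assms by (auto simp: kernel_def equalizer_def)
qed

lemma kernel_lift:
  assumes "kernel f k" "a \<in> hom W (Dom C f)" "f \<cdot> a = zero W (Cod C f)"
  obtains u where "u \<in> hom W (Dom C k)" "k \<cdot> u = a"
proof -
  have "f \<cdot> a = zero (Dom C f) (Cod C f) \<cdot> a" using assms kernel_hom[OF assms(1)] by simp
  then show thesis using assms that unfolding kernel_def equalizer_def by blast
qed

lemma kernel_monic:
  assumes "kernel f k"
  shows "monic k"
  unfolding monic_def
proof (intro conjI allI ballI impI)
  note [simp] = kernel_hom[OF assms]
  show "k \<in> Arr C" by simp
  fix W u v assume u: "u \<in> hom W (Dom C k)" and v: "v \<in> hom W (Dom C k)" and eq: "k \<cdot> u = k \<cdot> v"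
  have "k \<cdot> v \<in> hom W (Dom C f)" "f \<cdot> (k \<cdot> v) = zero (Dom C f) (Cod C f) \<cdot> (k \<cdot> v)"
    using v comp_reduce[OF kernel_hom(4)[OF assms], of v] by simp_all
  then have "\<exists>!w. w \<in> hom W (Dom C k) \<and> k \<cdot> w = k \<cdot> v"
    using assms unfolding kernel_def equalizer_def by blast
  then show "u = v" using u v eq by blast
qed

lemma kernelI:
  assumes "f \<in> Arr C" "monic k" "Cod C k = Dom C f" "f \<cdot> k = zero (Dom C k) (Cod C f)"
    "\<And>W a. \<lbrakk>a \<in> hom W (Dom C f); f \<cdot> a = zero W (Cod C f)\<rbrakk> \<Longrightarrow> \<exists>u \<in> hom W (Dom C k). k \<cdot> u = a"
  shows "kernel f k"
  unfolding kernel_def equalizer_def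
proof (intro conjI allI ballI impI)
  note [simp] = assms(1,3,4) monic_Arr[OF assms(2)]
  show "parallel f (zero (Dom C f) (Cod C f))" "k \<in> hom (Dom C k) (Dom C f)"
    "f \<cdot> k = zero (Dom C f) (Cod C f) \<cdot> k"
    by (simp_all add: parallel_def)
  fix W a assume a: "a \<in> hom W (Dom C f)" and "f \<cdot> a = zero (Dom C f) (Cod C f) \<cdot> a"
  then have "f \<cdot> a = zero W (Cod C f)" by simp
  then obtain u where "u \<in> hom W (Dom C k)" "k \<cdot> u = a" using assms(5)[OF a] by blast
  then show "\<exists>!u. u \<in> hom W (Dom C k) \<and> k \<cdot> u = a"
    using monic_cancel[OF assms(2)] by blast
qed

lemma kernel_ker:
  assumes "f \<in> Arr C"
  shows "kernel f (ker f)"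
proof -
  have "parallel f (zero (Dom C f) (Cod C f))" using assms by (simp add: parallel_def)
  then have "\<exists>k. kernel f k"
    using finitely_complete unfolding finitely_complete_def kernel_def by blast
  then show ?thesis unfolding ker_def by (rule someI_ex)
qed

subsection \<open>Protomodularity and exactness\<close>

text \<open>Elementwise, \<open>m \<cdot> i\<close> is \<open>a \<mapsto> (a, s' (p a))\<close> and
  \<open>m \<cdot> j\<close> is a section of \<open>q'\<close>. So \<open>m\<close> is a morphism of
  points over \<open>Dom C p'\<close>, and its change of base along \<open>s'\<close> is invertible,
  because over \<open>s'\<close> only the pairs \<open>(a, s' (p a))\<close> remain and these
  already come from \<open>i\<close>.\<close>

lemma point_pullback_extremal:
  assumes pt: "point Y p s" "point Y p' s'" and pb: "pullback p p' q q'"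
    and m: "monic m" "Cod C m = Dom C q"
    and i: "i \<in> hom (Dom C p) (Dom C m)" "q \<cdot> (m \<cdot> i) = Id C (Dom C p)" "q' \<cdot> (m \<cdot> i) = s' \<cdot> p"
    and j: "j \<in> hom (Dom C p') (Dom C m)" "q' \<cdot> (m \<cdot> j) = Id C (Dom C p')"
  shows "iso m"
proof -
  have [simp]: "p \<in> Arr C" "Cod C p = Y" "s \<in> Arr C" "Dom C s = Y" "Cod C s = Dom C p" "p \<cdot> s = Id C Y"
    "p' \<in> Arr C" "Cod C p' = Y" "s' \<in> Arr C" "Dom C s' = Y" "Cod C s' = Dom C p'"
    and ps': "p' \<cdot> s' = Id C Y"
    using pt by (auto simp: point_def)
  note [simp] = pullback_hom[OF pb] monic_Arr[OF m(1)] m(2)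
  have [simp]: "i \<in> Arr C" "Dom C i = Dom C p" "Cod C i = Dom C m"
    "j \<in> Arr C" "Dom C j = Dom C p'" "Cod C j = Dom C m"
    using i(1) j(1) by auto
  \<comment> \<open>An element of the pullback lying over \<open>s' \<cdot> y\<close> is a pair
    \<open>(a, s' (p a))\<close>, so it is recovered from its first component.\<close>
  have mi_q: "(m \<cdot> i) \<cdot> (q \<cdot> x) = x"
    if x: "x \<in> hom W (Dom C q)" and y: "y \<in> hom W Y" and eq: "q' \<cdot> x = s' \<cdot> y" for W x y
  proof (rule pullback_eqI[OF pb])
    have "p \<cdot> (q \<cdot> x) = p' \<cdot> (q' \<cdot> x)"
      using comp_reduce[OF pullback_hom(9)[OF pb], of x] x by simp
    also have "\<dots> = y" using comp_reduce[OF ps', of y] eq y by simp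
    finally have "p \<cdot> (q \<cdot> x) = y" .
    then show "q' \<cdot> ((m \<cdot> i) \<cdot> (q \<cdot> x)) = q' \<cdot> x"
      using comp_reduce[OF i(3), of "q \<cdot> x"] x eq by simp
    show "q \<cdot> ((m \<cdot> i) \<cdot> (q \<cdot> x)) = q \<cdot> x"
      using comp_reduce[OF i(2), of "q \<cdot> x"] x by simp
  qed (use x in simp_all)
  \<comment> \<open>The points are \<open>(q' \<cdot> m, j)\<close> and
    \<open>(q', m \<cdot> j)\<close>. The next two facts show that both pull back along
    \<open>s'\<close> to \<open>p\<close>, with the identity as comparison.\<close>
  have "point_morphism (Dom C p') (q' \<cdot> m) j q' (m \<cdot> j) m"
    using j(2) by (simp add: point_morphism_def point_def)
  moreover have "pullback (q' \<cdot> m) s' i p"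
  proof (rule pullbackI)
    fix W a b assume a: "a \<in> hom W (Dom C (q' \<cdot> m))" and b: "b \<in> hom W (Dom C s')"
      and eq: "(q' \<cdot> m) \<cdot> a = s' \<cdot> b"
    have *: "(m \<cdot> i) \<cdot> (q \<cdot> (m \<cdot> a)) = m \<cdot> a" by (rule mi_q[of _ W b]) (use a b eq in simp_all)
    have "i \<cdot> (q \<cdot> (m \<cdot> a)) = a"
      by (rule monic_cancel[OF m(1), of _ W]) (use a * in simp_all)
    moreover have "p \<cdot> (q \<cdot> (m \<cdot> a)) = b"
      using comp_reduce[OF pullback_hom(9)[OF pb], of "m \<cdot> a"] a b eq comp_reduce[OF ps', of b] by simp
    ultimately show "\<exists>u\<in>hom W (Dom C i). i \<cdot> u = a \<and> p \<cdot> u = b"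
      using a by (intro bexI[of _ "q \<cdot> (m \<cdot> a)"]) simp_all
  next
    fix W u v assume u: "u \<in> hom W (Dom C i)" and v: "v \<in> hom W (Dom C i)" and "i \<cdot> u = i \<cdot> v"
    then show "u = v" using comp_reduce[OF i(2), of u] comp_reduce[OF i(2), of v] by simp
  qed (use i in simp_all)
  moreover have "pullback q' s' (m \<cdot> i) p"
  proof (rule pullbackI)
    fix W a b assume a: "a \<in> hom W (Dom C q')" and b: "b \<in> hom W (Dom C s')"
      and eq: "q' \<cdot> a = s' \<cdot> b"
    have "(m \<cdot> i) \<cdot> (q \<cdot> a) = a" by (rule mi_q[of _ W b]) (use a b eq in simp_all)
    moreover have "p \<cdot> (q \<cdot> a) = b"
      using comp_reduce[OF pullback_hom(9)[OF pb], of a] a b eq comp_reduce[OF ps', of b] by simp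
    ultimately show "\<exists>u\<in>hom W (Dom C (m \<cdot> i)). (m \<cdot> i) \<cdot> u = a \<and> p \<cdot> u = b"
      using a by (intro bexI[of _ "q \<cdot> a"]) simp_all
  next
    fix W u v assume u: "u \<in> hom W (Dom C (m \<cdot> i))" and v: "v \<in> hom W (Dom C (m \<cdot> i))"
      and eq: "(m \<cdot> i) \<cdot> u = (m \<cdot> i) \<cdot> v"
    have "u = q \<cdot> ((m \<cdot> i) \<cdot> u)" using comp_reduce[OF i(2), of u] u by simp
    also have "\<dots> = v" unfolding eq using comp_reduce[OF i(2), of v] v by simp
    finally show "u = v" .
  qed (use i in simp_all)
  moreover have "Id C (Dom C p) \<in> hom (Dom C i) (Dom C (m \<cdot> i))"
    "(m \<cdot> i) \<cdot> Id C (Dom C p) = m \<cdot> i" "p \<cdot> Id C (Dom C p) = p" "iso (Id C (Dom C p))"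
    by (simp_all add: iso_Id)
  ultimately show "iso m"
    by (intro protomodular[unfolded protomodular_def, rule_format,
        of "Dom C p'" "q' \<cdot> m" j q' "m \<cdot> j" m s' i p "m \<cdot> i" p "Id C (Dom C p)"] conjI)
qed

section \<open>The Mal'tsev property of reflexive relations\<close>

lemma pair_monic:
  assumes "parallel r s"
    "\<And>W u v. \<lbrakk>u \<in> hom W (Dom C r); v \<in> hom W (Dom C r); r \<cdot> u = r \<cdot> v; s \<cdot> u = s \<cdot> v\<rbrakk> \<Longrightarrow> u = v"
  shows "monic (pair r s)"
  unfolding monic_def
proof (intro conjI allI ballI impI)
  have [simp]: "r \<in> Arr C" "s \<in> Arr C" "Dom C s = Dom C r" "Cod C s = Cod C r"
    using assms(1) by (auto simp: parallel_def)
  show "pair r s \<in> Arr C" by simp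
  fix W u v assume u: "u \<in> hom W (Dom C (pair r s))" and v: "v \<in> hom W (Dom C (pair r s))"
    and eq: "pair r s \<cdot> u = pair r s \<cdot> v"
  have 1: "proj1 (Cod C r) (Cod C r) \<cdot> pair r s = r" "proj2 (Cod C r) (Cod C r) \<cdot> pair r s = s"
    by simp_all
  show "u = v"
    by (rule assms(2)[of _ W])
      (use u v eq comp_reduce[OF 1(1), of u] comp_reduce[OF 1(1), of v]
        comp_reduce[OF 1(2), of u] comp_reduce[OF 1(2), of v] in simp_all)
qed

text \<open>In elementwise terms: if \<open>x R y\<close>, \<open>z R y\<close> and \<open>z R w\<close> then \<open>x R w\<close>. The chains
  \<open>(x, y, z, w)\<close> form the pullback, over the object \<open>R\<close> of pairs \<open>(z, y)\<close>, of two points; those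
  with \<open>x R w\<close> contain the chains with \<open>x = z\<close> and those with \<open>y = w\<close>.\<close>

lemma reflexive_relation_difunctional:
  assumes par: "parallel r s"
    and jm: "\<And>W u v. \<lbrakk>u \<in> hom W (Dom C r); v \<in> hom W (Dom C r); r \<cdot> u = r \<cdot> v; s \<cdot> u = s \<cdot> v\<rbrakk> \<Longrightarrow> u = v"
    and \<alpha>: "\<alpha> \<in> hom W (Dom C r)" and \<beta>: "\<beta> \<in> hom W (Dom C r)" and \<gamma>: "\<gamma> \<in> hom W (Dom C r)"
    and eqs: "s \<cdot> \<alpha> = s \<cdot> \<beta>" "r \<cdot> \<beta> = r \<cdot> \<gamma>"
  obtains \<delta> where "\<delta> \<in> hom W (Dom C r)" "r \<cdot> \<delta> = r \<cdot> \<alpha>" "s \<cdot> \<delta> = s \<cdot> \<gamma>"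
proof -
  define R where "R = Dom C r"
  have [simp]: "r \<in> Arr C" "s \<in> Arr C" "Dom C r = R" "Dom C s = R" "Cod C s = Cod C r" "R \<in> Obj C"
    using par by (auto simp: parallel_def R_def)
  note [simp] = \<alpha>[unfolded R_def[symmetric], simplified] \<beta>[unfolded R_def[symmetric], simplified]
    \<gamma>[unfolded R_def[symmetric], simplified]
  \<comment> \<open>With \<open>r\<close> and \<open>s\<close> read as first and second entry, the
    first pullback collects pairs of links \<open>(x, y)\<close>, \<open>(z, y)\<close> and the
    second one pairs \<open>(z, y)\<close>, \<open>(z, w)\<close>. The diagonals \<open>dA\<close>
    and \<open>dB\<close> repeat a link.\<close>
  obtain a1 a2 where A: "pullback s s a1 a2" using pullback_exists[of s s] by auto
  obtain b1 b2 where B: "pullback r r b1 b2" using pullback_exists[of r r] by auto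
  note [simp] = pullback_hom(4,5,6,7,8)[OF A] pullback_hom(4,5,6,7,8)[OF B]
  note aeq = pullback_hom(9)[OF A] and beq = pullback_hom(9)[OF B]
  obtain dA where [simp]: "dA \<in> Arr C" "Dom C dA = R" "Cod C dA = Dom C a1"
    and dA: "a1 \<cdot> dA = Id C R" "a2 \<cdot> dA = Id C R"
    by (rule pullback_lift[OF A, of "Id C R" R "Id C R"]) auto
  obtain dB where [simp]: "dB \<in> Arr C" "Dom C dB = R" "Cod C dB = Dom C b1"
    and dB: "b1 \<cdot> dB = Id C R" "b2 \<cdot> dB = Id C R"
    by (rule pullback_lift[OF B, of "Id C R" R "Id C R"]) auto
  note red [simp] = dA dB comp_reduce[OF dA(1)] comp_reduce[OF dA(2)]
    comp_reduce[OF dB(1)] comp_reduce[OF dB(2)]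
  have ptA: "point R a2 dA" and ptB: "point R b1 dB" by (simp_all add: point_def)
  obtain q1 q2 where P: "pullback a2 b1 q1 q2" using pullback_exists[of a2 b1] by auto
  note [simp] = pullback_hom(4,5,6,7,8)[OF P]
  \<comment> \<open>\<open>?f\<close> takes a chain to its ends \<open>(x, w)\<close>. Pulling
    \<open>?m\<close> back along it gives the subobject \<open>m\<close> of chains with related
    ends, and \<open>n\<close> is the link between them.\<close>
  let ?m = "pair r s" and ?f = "pair (r \<cdot> (a1 \<cdot> q1)) (s \<cdot> (b2 \<cdot> q2))"
  have mon: "monic ?m" by (rule pair_monic) (use par jm in auto)
  obtain m n where M: "pullback ?f ?m m n" using pullback_exists[of ?f ?m] by auto
  note [simp] = pullback_hom(4,5,6,7,8)[OF M, simplified]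
  have pm: "monic m" by (rule pullback_monic[OF M mon])
  have pr: "proj1 (Cod C r) (Cod C r) \<cdot> ?m = r" "proj2 (Cod C r) (Cod C r) \<cdot> ?m = s"
    "proj1 (Cod C r) (Cod C r) \<cdot> ?f = r \<cdot> (a1 \<cdot> q1)" "proj2 (Cod C r) (Cod C r) \<cdot> ?f = s \<cdot> (b2 \<cdot> q2)"
    by simp_all
  note pr' = pr[THEN comp_reduce]
  have cond: "?f \<cdot> x = ?m \<cdot> y"
    if "x \<in> hom V (Dom C q1)" "y \<in> hom V R" "r \<cdot> (a1 \<cdot> (q1 \<cdot> x)) = r \<cdot> y"
      "s \<cdot> (b2 \<cdot> (q2 \<cdot> x)) = s \<cdot> y" for x y V
    by (rule prod_eqI[of "Cod C r" "Cod C r" _ V]) (use that pr' in simp_all)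
  obtain i0 where [simp]: "i0 \<in> Arr C" "Dom C i0 = Dom C a1" "Cod C i0 = Dom C q1"
    and i0: "q1 \<cdot> i0 = Id C (Dom C a1)" "q2 \<cdot> i0 = dB \<cdot> a2"
    by (rule pullback_lift[OF P, of "Id C (Dom C a1)" "Dom C a1" "dB \<cdot> a2"]) auto
  obtain j0 where [simp]: "j0 \<in> Arr C" "Dom C j0 = Dom C b1" "Cod C j0 = Dom C q1"
    and j0: "q1 \<cdot> j0 = dA \<cdot> b1" "q2 \<cdot> j0 = Id C (Dom C b1)"
    by (rule pullback_lift[OF P, of "dA \<cdot> b1" "Dom C b1" "Id C (Dom C b1)"]) auto
  \<comment> \<open>For a chain with \<open>w = y\<close> the ends are linked by its first link
    \<open>a1\<close>; for one with \<open>x = z\<close>, treated next, by its last link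
    \<open>b2\<close>.\<close>
  have "?f \<cdot> i0 = ?m \<cdot> a1" by (rule cond[of _ "Dom C a1"]) (use i0 aeq in simp_all)
  then obtain i where i: "i \<in> hom (Dom C a1) (Dom C m)" "m \<cdot> i = i0"
    using pullback_lift[OF M, of i0 "Dom C a1" a1] by auto
  have "?f \<cdot> j0 = ?m \<cdot> b2" by (rule cond[of _ "Dom C b1"]) (use j0 beq in simp_all)
  then obtain j where j: "j \<in> hom (Dom C b1) (Dom C m)" "m \<cdot> j = j0"
    using pullback_lift[OF M, of j0 "Dom C b1" b2] by auto
  have "iso m"
    by (rule point_pullback_extremal[OF ptA ptB P pm, of i j]) (use i j i0 j0 in simp_all)
  then obtain t where [simp]: "t \<in> Arr C" "Dom C t = Dom C q1" "Cod C t = Dom C m"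
    and t: "m \<cdot> t = Id C (Dom C q1)"
    by (auto simp: iso_def)
  obtain x where [simp]: "x \<in> Arr C" "Dom C x = W" "Cod C x = Dom C a1" and x: "a1 \<cdot> x = \<alpha>" "a2 \<cdot> x = \<beta>"
    by (rule pullback_lift[OF A, of \<alpha> W \<beta>]) (use eqs in auto)
  obtain y where [simp]: "y \<in> Arr C" "Dom C y = W" "Cod C y = Dom C b1" and y: "b1 \<cdot> y = \<beta>" "b2 \<cdot> y = \<gamma>"
    by (rule pullback_lift[OF B, of \<beta> W \<gamma>]) (use eqs in auto)
  obtain w where [simp]: "w \<in> Arr C" "Dom C w = W" "Cod C w = Dom C q1" and w: "q1 \<cdot> w = x" "q2 \<cdot> w = y"
    by (rule pullback_lift[OF P, of x W y]) (use x y in auto)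
  let ?\<delta> = "n \<cdot> (t \<cdot> w)"
  have "?f \<cdot> w = ?m \<cdot> ?\<delta>"
    using comp_reduce[OF pullback_hom(9)[OF M], of "t \<cdot> w"] comp_reduce[OF t, of w] by simp
  then have "proj1 (Cod C r) (Cod C r) \<cdot> (?f \<cdot> w) = proj1 (Cod C r) (Cod C r) \<cdot> (?m \<cdot> ?\<delta>)"
    "proj2 (Cod C r) (Cod C r) \<cdot> (?f \<cdot> w) = proj2 (Cod C r) (Cod C r) \<cdot> (?m \<cdot> ?\<delta>)"
    by simp_all
  then have "r \<cdot> ?\<delta> = r \<cdot> \<alpha>" "s \<cdot> ?\<delta> = s \<cdot> \<gamma>"
    using w x y by (simp_all add: pr')
  then show thesis by (intro that[of ?\<delta>]) simp_all
qed

text \<open>Reflexivity supplies the degenerate links that turn difunctionality into symmetry and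
  transitivity. With exactness, every internal reflexive relation thus becomes a kernel
  pair.\<close>

lemma reflexive_relation_equivalence:
  assumes par: "parallel r s"
    and jm: "\<And>W u v. \<lbrakk>u \<in> hom W (Dom C r); v \<in> hom W (Dom C r); r \<cdot> u = r \<cdot> v; s \<cdot> u = s \<cdot> v\<rbrakk> \<Longrightarrow> u = v"
    and d: "d \<in> hom (Cod C r) (Dom C r)" "r \<cdot> d = Id C (Cod C r)" "s \<cdot> d = Id C (Cod C r)"
  shows "equivalence_relation r s"
  unfolding equivalence_relation_def
proof (intro conjI allI impI ballI)
  have [simp]: "r \<in> Arr C" "s \<in> Arr C" "Dom C s = Dom C r" "Cod C s = Cod C r"
    "d \<in> Arr C" "Dom C d = Cod C r" "Cod C d = Dom C r"
    using par d by (auto simp: parallel_def)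
  note red = comp_reduce[OF d(2)] comp_reduce[OF d(3)]
  show "parallel r s" by (rule par)
  show "u = v" if "u \<in> hom W (Dom C r)" "v \<in> hom W (Dom C r)" "r \<cdot> u = r \<cdot> v \<and> s \<cdot> u = s \<cdot> v" for W u v
    using jm that by blast
  show "\<exists>d\<in>hom (Cod C r) (Dom C r). r \<cdot> d = Id C (Cod C r) \<and> s \<cdot> d = Id C (Cod C r)"
    using d by blast
  \<comment> \<open>The links \<open>(y, y)\<close>, \<open>(x, y)\<close>, \<open>(x, x)\<close>
    yield \<open>(y, x)\<close>.\<close>
  obtain t where "t \<in> hom (Dom C r) (Dom C r)" "r \<cdot> t = r \<cdot> (d \<cdot> s)" "s \<cdot> t = s \<cdot> (d \<cdot> r)"
    by (rule reflexive_relation_difunctional[of r s "d \<cdot> s" "Dom C r" "Id C (Dom C r)" "d \<cdot> r"],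
        rule par, erule (3) jm) (auto simp: red)
  then show "\<exists>t\<in>hom (Dom C r) (Dom C r). r \<cdot> t = s \<and> s \<cdot> t = r"
    by (intro bexI[of _ t]) (simp_all add: red)
  fix a b assume ab: "pullback s r a b"
  note [simp] = pullback_hom(4,5,6,7,8)[OF ab] and eq = pullback_hom(9)[OF ab]
  \<comment> \<open>The links \<open>(x, y)\<close>, \<open>(y, y)\<close>, \<open>(y, z)\<close>
    yield \<open>(x, z)\<close>.\<close>
  obtain t where "t \<in> hom (Dom C a) (Dom C r)" "r \<cdot> t = r \<cdot> a" "s \<cdot> t = s \<cdot> b"
    by (rule reflexive_relation_difunctional[of r s a "Dom C a" "d \<cdot> (r \<cdot> b)" b],
        rule par, erule (3) jm) (auto simp: red eq)
  then show "\<exists>t\<in>hom (Dom C a) (Dom C r). r \<cdot> t = r \<cdot> a \<and> s \<cdot> t = s \<cdot> b" by blast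
qed

text \<open>Stability of regular epimorphisms under pullback, read as the lifting of a generalised
  element after passing to a cover. It replaces the choice of preimages in the arguments
  below.\<close>

lemma regular_epi_cover:
  assumes "regular_epi e" "x \<in> hom W (Cod C e)"
  obtains W' e' x' where "regular_epi e'" "e' \<in> hom W' W" "x' \<in> hom W' (Dom C e)" "e \<cdot> x' = x \<cdot> e'"
proof -
  note [simp] = regular_epi_Arr[OF assms(1)]
  obtain p q where pq: "pullback e x p q" using pullback_exists[of e x] assms by auto
  have "regular_epi q" by (rule regular_epi_pullback[OF pq assms(1)])
  with that[of q "Dom C q" p] pullback_hom[OF pq] assms show thesis by auto
qed

text \<open>\<open>e\<close> is the coequaliser of the kernel pair of \<open>f\<close>. The induced
  \<open>m\<close> is monic because, on a common cover, elements that \<open>m\<close> identifies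
  lift to elements that \<open>f\<close> identifies; these form an element of the kernel pair, which
  \<open>e\<close> collapses.\<close>

lemma image_factorisation:
  assumes "f \<in> Arr C"
  obtains e m where "regular_epi e" "monic m" "Cod C e = Dom C m" "m \<cdot> e = f"
proof -
  note [simp] = assms
  obtain r s where rs: "pullback f f r s" using pullback_exists[of f f] by auto
  note [simp] = pullback_hom(4,5,6,7,8)[OF rs] and req = pullback_hom(9)[OF rs]
  obtain e where e: "coequalizer r s e"
    using kernel_pair_coequalizer[of f r s] rs unfolding kernel_pair_def by blast
  then have re: "regular_epi e" unfolding regular_epi_def by blast
  have [simp]: "e \<in> Arr C" "Dom C e = Dom C f" and er: "e \<cdot> r = e \<cdot> s"
    using e by (auto simp: coequalizer_def)
  have "f \<in> hom (Cod C r) (Cod C f)" by simp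
  then obtain m where m: "m \<in> hom (Cod C e) (Cod C f)" and me: "m \<cdot> e = f"
    using coequalizer_factor[OF e _ req] by blast
  note [simp] = m[simplified]
  have "monic m"
    unfolding monic_def
  proof (intro conjI allI ballI impI)
    fix W x y assume x: "x \<in> hom W (Dom C m)" and y: "y \<in> hom W (Dom C m)" and eq: "m \<cdot> x = m \<cdot> y"
    obtain W1 e1 x' where 1: "regular_epi e1" "e1 \<in> hom W1 W" "x' \<in> hom W1 (Dom C e)" "e \<cdot> x' = x \<cdot> e1"
      by (rule regular_epi_cover[OF re, of x W]) (use x in auto)
    obtain W2 e2 y' where 2: "regular_epi e2" "e2 \<in> hom W2 W1" "y' \<in> hom W2 (Dom C e)"
      "e \<cdot> y' = (y \<cdot> e1) \<cdot> e2"
      by (rule regular_epi_cover[OF re, of "y \<cdot> e1" W1]) (use y 1 in auto)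
    note [simp] = 1(2,3)[simplified] 2(2,3)[simplified] x[simplified] y[simplified]
    have "f \<cdot> (x' \<cdot> e2) = m \<cdot> (e \<cdot> (x' \<cdot> e2))" using comp_reduce[OF me, of "x' \<cdot> e2"] by simp
    also have "\<dots> = m \<cdot> (x \<cdot> (e1 \<cdot> e2))" using comp_reduce[OF 1(4), of e2] by simp
    also have "\<dots> = m \<cdot> (y \<cdot> (e1 \<cdot> e2))" using comp_reduce[OF eq, of "e1 \<cdot> e2"] by simp
    also have "\<dots> = m \<cdot> (e \<cdot> y')" using 2(4) by simp
    also have "\<dots> = f \<cdot> y'" using comp_reduce[OF me, of y'] by simp
    finally obtain w where w: "w \<in> hom W2 (Dom C r)" "r \<cdot> w = x' \<cdot> e2" "s \<cdot> w = y'"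
      using pullback_lift[OF rs, of "x' \<cdot> e2" W2 y'] by auto
    have "(x \<cdot> e1) \<cdot> e2 = e \<cdot> (r \<cdot> w)" using comp_reduce[OF 1(4), of e2] w by simp
    also have "\<dots> = (y \<cdot> e1) \<cdot> e2" using comp_reduce[OF er, of w] w 2(4) by simp
    finally have "x \<cdot> e1 = y \<cdot> e1"
      by (intro regular_epi_cancel[OF 2(1), of "x \<cdot> e1" "Cod C e" "y \<cdot> e1"]) simp_all
    then show "x = y" using regular_epi_cancel[OF 1(1), of x "Cod C e" y] by simp
  qed simp
  with that re me show thesis by simp
qed

text \<open>The image of \<open>(u, v)\<close> in \<open>Y \<times> Y\<close> is a reflexive relation, hence the kernel pair of its
  coequaliser: two generalised elements identified by \<open>c\<close> come, locally for the regular topology,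
  from a single element of \<open>X\<close>.\<close>

lemma reflexive_pair_coequalizer:
  assumes u: "u \<in> hom X Y" and v: "v \<in> hom X Y"
    and t: "t \<in> hom Y X" "u \<cdot> t = Id C Y" "v \<cdot> t = Id C Y"
  obtains c where "coequalizer u v c" "regular_epi c"
    "\<And>W x y. \<lbrakk>x \<in> hom W Y; y \<in> hom W Y; c \<cdot> x = c \<cdot> y\<rbrakk> \<Longrightarrow>
      \<exists>W' e w. regular_epi e \<and> e \<in> hom W' W \<and> w \<in> hom W' X \<and> u \<cdot> w = x \<cdot> e \<and> v \<cdot> w = y \<cdot> e"
proof -
  have [simp]: "Y \<in> Obj C" using u by auto
  note [simp] = u[simplified] v[simplified] t(1)[simplified]
  obtain e m where e: "regular_epi e" and m: "monic m" and [simp]: "Cod C e = Dom C m" and em: "m \<cdot> e = pair u v"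
    by (rule image_factorisation[of "pair u v"]) auto
  note [simp] = regular_epi_Arr[OF e] monic_Arr[OF m]
  have [simp]: "Dom C e = X" "Cod C m = prod Y Y"
    using arg_cong[OF em, of "Dom C"] arg_cong[OF em, of "Cod C"] by simp_all
  define r s where "r = proj1 Y Y \<cdot> m" and "s = proj2 Y Y \<cdot> m"
  have [simp]: "r \<in> Arr C" "Dom C r = Dom C m" "Cod C r = Y" "s \<in> Arr C" "Dom C s = Dom C m" "Cod C s = Y"
    by (simp_all add: r_def s_def)
  have re: "r \<cdot> e = u" and se: "s \<cdot> e = v" by (simp_all add: r_def s_def em)
  have par: "parallel r s" by (simp add: parallel_def)
  have "equivalence_relation r s"
  proof (rule reflexive_relation_equivalence[OF par, of "e \<cdot> t"])
    show "x = y" if "x \<in> hom W (Dom C r)" "y \<in> hom W (Dom C r)" "r \<cdot> x = r \<cdot> y" "s \<cdot> x = s \<cdot> y" for W x y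
    proof (rule monic_cancel[OF m, of _ W])
      show "m \<cdot> x = m \<cdot> y"
        by (rule prod_eqI[of Y Y _ W]) (use that in \<open>simp_all add: r_def s_def\<close>)
    qed (use that in simp_all)
  qed (use comp_reduce[OF re, of t] comp_reduce[OF se, of t] t in simp_all)
  then obtain f where f: "kernel_pair f r s" using equivalence_relation_effective by blast
  then obtain c where c: "coequalizer r s c" using kernel_pair_coequalizer by blast
  have pb: "pullback f f r s" using f unfolding kernel_pair_def .
  have [simp]: "f \<in> Arr C" "Dom C f = Y" and frs: "f \<cdot> r = f \<cdot> s"
    using pullback_hom[OF pb] by simp_all
  have [simp]: "c \<in> Arr C" "Dom C c = Y" and crs: "c \<cdot> r = c \<cdot> s"
    using c by (auto simp: coequalizer_def)
  \<comment> \<open>Arrows may be cancelled after \<open>e\<close>, so an arrow coequalises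
    \<open>(u, v)\<close> exactly when it coequalises the image \<open>(r, s)\<close>.\<close>
  have "coequalizer u v c"
    unfolding coequalizer_def
  proof (intro conjI allI ballI impI)
    show "parallel u v" by (simp add: parallel_def)
    show "c \<in> hom (Cod C u) (Cod C c)" by simp
    have "c \<cdot> (r \<cdot> e) = c \<cdot> (s \<cdot> e)" using comp_reduce[OF crs, of e] by simp
    then show "c \<cdot> u = c \<cdot> v" by (simp add: re se)
    fix W a assume a: "a \<in> hom (Cod C u) W" and auv: "a \<cdot> u = a \<cdot> v"
    have "a \<cdot> r = a \<cdot> s"
      by (rule regular_epi_cancel[OF e, of _ W]) (use a auv in \<open>simp_all add: re se\<close>)
    with a c show "\<exists>!w. w \<in> hom (Cod C c) W \<and> w \<cdot> c = a" unfolding coequalizer_def by simp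
  qed
  moreover have "\<exists>W' e' w. regular_epi e' \<and> e' \<in> hom W' W \<and> w \<in> hom W' X \<and> u \<cdot> w = x \<cdot> e' \<and> v \<cdot> w = y \<cdot> e'"
    if x: "x \<in> hom W Y" and y: "y \<in> hom W Y" and cxy: "c \<cdot> x = c \<cdot> y" for W x y
  proof -
    \<comment> \<open>\<open>f\<close> factors through \<open>c\<close>, so what \<open>c\<close>
      identifies lies in the kernel pair \<open>(r, s)\<close> of \<open>f\<close>; lifting along
      \<open>e\<close> then reaches \<open>X\<close> itself.\<close>
    have "f \<in> hom (Cod C r) (Cod C f)" by simp
    then obtain f' where f': "f' \<in> hom (Cod C c) (Cod C f)" "f' \<cdot> c = f"
      using coequalizer_factor[OF c _ frs] by blast
    have "f \<cdot> x = f \<cdot> y"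
      using comp_reduce[OF f'(2), of x] comp_reduce[OF f'(2), of y] f'(1) x y cxy by simp
    then obtain z where z: "z \<in> hom W (Dom C r)" "r \<cdot> z = x" "s \<cdot> z = y"
      using pullback_lift[OF pb, of x W y] x y by auto
    obtain W' e' w where *: "regular_epi e'" "e' \<in> hom W' W" "w \<in> hom W' (Dom C e)" "e \<cdot> w = z \<cdot> e'"
      by (rule regular_epi_cover[OF e, of z W]) (use z in auto)
    have "u \<cdot> w = x \<cdot> e'"
      using comp_reduce[OF re, of w] comp_reduce[OF z(2), of e'] * z by simp
    moreover have "v \<cdot> w = y \<cdot> e'"
      using comp_reduce[OF se, of w] comp_reduce[OF z(3), of e'] * z by simp
    ultimately show ?thesis using * by auto
  qed
  moreover have "regular_epi c" using c unfolding regular_epi_def by blast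
  ultimately show thesis using that by blast
qed

subsection \<open>Internal actions\<close>

lemma retraction_hom [simp]:
  assumes "B \<in> Obj C" "X \<in> Obj C"
  shows "retraction B X \<in> Arr C" "Dom C (retraction B X) = coprod B X" "Cod C (retraction B X) = B"
    "retraction B X \<cdot> inj1 B X = Id C B" "retraction B X \<cdot> inj2 B X = zero X B"
  using assms by (simp_all add: retraction_def)

lemma flat_Dom [simp]: "Dom C (ker (retraction B X)) = flat B X"
  by (simp add: flat_def)

lemma ker_retraction_hom [simp]:
  assumes "B \<in> Obj C" "X \<in> Obj C"
  shows "ker (retraction B X) \<in> Arr C" "Cod C (ker (retraction B X)) = coprod B X"
    "flat B X \<in> Obj C"
proof -
  have "kernel (retraction B X) (ker (retraction B X))" using assms by (simp add: kernel_ker)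
  from kernel_hom[OF this] show *: "ker (retraction B X) \<in> Arr C" "Cod C (ker (retraction B X)) = coprod B X"
    using assms by simp_all
  then show "flat B X \<in> Obj C" using Dom_Obj[of "ker (retraction B X)"] by simp
qed

lemma retraction_ker [simp]:
  assumes "B \<in> Obj C" "X \<in> Obj C"
  shows "retraction B X \<cdot> ker (retraction B X) = zero (flat B X) B"
  using kernel_hom(4)[OF kernel_ker[of "retraction B X"]] assms by simp

lemma ker_retraction_cancel:
  assumes "B \<in> Obj C" "X \<in> Obj C" "u \<in> hom W (flat B X)" "v \<in> hom W (flat B X)"
    "ker (retraction B X) \<cdot> u = ker (retraction B X) \<cdot> v"
  shows "u = v"
  using monic_cancel[OF kernel_monic[OF kernel_ker[of "retraction B X"]], of u W v] assms by simp

lemma ker_retraction_lift: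
  assumes "B \<in> Obj C" "X \<in> Obj C" "a \<in> hom W (coprod B X)" "retraction B X \<cdot> a = zero W B"
  obtains u where "u \<in> hom W (flat B X)" "ker (retraction B X) \<cdot> u = a"
  using kernel_lift[OF kernel_ker[of "retraction B X"], of a W] assms by auto

lemma ker_map_props:
  assumes "p \<in> Arr C" "p' \<in> Arr C" "Cod C p' = Cod C p" "f \<in> hom (Dom C p) (Dom C p')" "p' \<cdot> f = p"
  shows "ker_map p p' f \<in> hom (Dom C (ker p)) (Dom C (ker p')) \<and> ker p' \<cdot> ker_map p p' f = f \<cdot> ker p"
proof -
  note k = kernel_ker[OF assms(1)] and k' = kernel_ker[OF assms(2)]
  note [simp] = kernel_hom(2,3)[OF k] kernel_hom(2,3)[OF k']
  have "p' \<cdot> (f \<cdot> ker p) = zero (Dom C (ker p)) (Cod C p')"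
    using comp_reduce[OF assms(5), of "ker p"] kernel_hom(4)[OF k] assms by simp
  then obtain u where "u \<in> hom (Dom C (ker p)) (Dom C (ker p'))" "ker p' \<cdot> u = f \<cdot> ker p"
    using kernel_lift[OF k', of "f \<cdot> ker p" "Dom C (ker p)"] assms by auto
  then have "\<exists>!u. u \<in> hom (Dom C (ker p)) (Dom C (ker p')) \<and> ker p' \<cdot> u = f \<cdot> ker p"
    using monic_cancel[OF kernel_monic[OF k']] by metis
  then show ?thesis unfolding ker_map_def by (rule theI')
qed

lemma sum_map_hom [simp]:
  assumes "B \<in> Obj C" "f \<in> Arr C"
  shows "sum_map B f \<in> Arr C" "Dom C (sum_map B f) = coprod B (Dom C f)"
    "Cod C (sum_map B f) = coprod B (Cod C f)"
  using assms by (simp_all add: sum_map_def)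

lemma sum_map_inj [simp]:
  assumes "B \<in> Obj C" "f \<in> Arr C" "Dom C f = X"
  shows "sum_map B f \<cdot> inj1 B X = inj1 B (Cod C f)" "sum_map B f \<cdot> inj2 B X = inj2 B (Cod C f) \<cdot> f"
  using assms by (simp_all add: sum_map_def)

lemma copair_sum_map [simp]:
  assumes "s \<in> Arr C" "k \<in> Arr C" "Dom C s = B" "Cod C s = Cod C k" "f \<in> Arr C" "Cod C f = Dom C k"
  shows "copair s k \<cdot> sum_map B f = copair s (k \<cdot> f)"
proof -
  have "B \<in> Obj C" using assms by auto
  then show ?thesis
    using assms comp_reduce[OF copair_inj(2)[of s k B "Dom C k"], of f]
    by (simp add: sum_map_def comp_copair)
qed

lemma retraction_sum_map [simp]:
  assumes "B \<in> Obj C" "f \<in> Arr C" "Cod C f = X"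
  shows "retraction B X \<cdot> sum_map B f = retraction B (Dom C f)"
proof -
  have "X \<in> Obj C" using assms by auto
  then show ?thesis using assms by (simp add: retraction_def)
qed

lemma flat_map_props:
  assumes "B \<in> Obj C" "f \<in> Arr C"
  shows "flat_map B f \<in> hom (flat B (Dom C f)) (flat B (Cod C f)) \<and>
    ker (retraction B (Cod C f)) \<cdot> flat_map B f = sum_map B f \<cdot> ker (retraction B (Dom C f))"
  using ker_map_props[of "retraction B (Dom C f)" "retraction B (Cod C f)" "sum_map B f"] assms
  by (simp add: flat_map_def)

lemma flat_map_hom [simp]:
  assumes "B \<in> Obj C" "f \<in> Arr C"
  shows "flat_map B f \<in> Arr C" "Dom C (flat_map B f) = flat B (Dom C f)"
    "Cod C (flat_map B f) = flat B (Cod C f)"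
  using flat_map_props[OF assms] by auto

lemma ker_flat_map:
  assumes "B \<in> Obj C" "f \<in> Arr C" "Cod C f = X"
  shows "ker (retraction B X) \<cdot> flat_map B f = sum_map B f \<cdot> ker (retraction B (Dom C f))"
  using flat_map_props[OF assms(1,2)] assms by auto

lemma flat_unit_props:
  assumes "B \<in> Obj C" "X \<in> Obj C"
  shows "flat_unit B X \<in> hom X (flat B X) \<and> ker (retraction B X) \<cdot> flat_unit B X = inj2 B X"
proof -
  obtain u where "u \<in> hom X (flat B X)" "ker (retraction B X) \<cdot> u = inj2 B X"
    using ker_retraction_lift[OF assms, of "inj2 B X" X] assms by auto
  then have "\<exists>!u. u \<in> hom X (flat B X) \<and> ker (retraction B X) \<cdot> u = inj2 B X"
    using ker_retraction_cancel[OF assms] by metis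
  then show ?thesis unfolding flat_unit_def by (rule theI')
qed

lemma flat_unit_hom [simp]:
  assumes "B \<in> Obj C" "X \<in> Obj C"
  shows "flat_unit B X \<in> Arr C" "Dom C (flat_unit B X) = X" "Cod C (flat_unit B X) = flat B X"
    "ker (retraction B X) \<cdot> flat_unit B X = inj2 B X"
  using flat_unit_props[OF assms] by auto

lemma flat_mult_props:
  assumes "B \<in> Obj C" "X \<in> Obj C"
  shows "flat_mult B X \<in> hom (flat B (flat B X)) (flat B X) \<and>
    ker (retraction B X) \<cdot> flat_mult B X =
      copair (inj1 B X) (ker (retraction B X)) \<cdot> ker (retraction B (flat B X))"
  unfolding flat_mult_def counit_def
  using ker_map_props[of "retraction B (flat B X)" "retraction B X" "copair (inj1 B X) (ker (retraction B X))"]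
    assms by (simp add: comp_copair retraction_def[symmetric])

lemma flat_mult_hom [simp]:
  assumes "B \<in> Obj C" "X \<in> Obj C"
  shows "flat_mult B X \<in> Arr C" "Dom C (flat_mult B X) = flat B (flat B X)"
    "Cod C (flat_mult B X) = flat B X"
  using flat_mult_props[OF assms] by auto

lemma ker_flat_mult:
  assumes "B \<in> Obj C" "X \<in> Obj C"
  shows "ker (retraction B X) \<cdot> flat_mult B X =
    copair (inj1 B X) (ker (retraction B X)) \<cdot> ker (retraction B (flat B X))"
  using flat_mult_props[OF assms] by blast

text \<open>The arrow \<open>\<chi>\<close> of the next lemma is the action of \<open>B\<close> on \<open>X\<close> obtained by conjugation in
  the codomain of \<open>k\<close>, along \<open>s\<close>.\<close>

lemma conjugation_action:
  assumes k: "monic k" and s: "s \<in> hom B (Cod C k)" and \<chi>: "\<chi> \<in> hom (flat B (Dom C k)) (Dom C k)"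
    and eq: "k \<cdot> \<chi> = copair s k \<cdot> ker (retraction B (Dom C k))"
  shows "action B (Dom C k) \<chi>"
proof -
  define X where "X = Dom C k"
  have B [simp]: "B \<in> Obj C" using s by auto
  note [simp] = monic_Arr[OF k] s[simplified] X_def[symmetric] \<chi>[folded X_def, simplified]
  have X [simp]: "X \<in> Obj C" using Dom_Obj[OF monic_Arr[OF k]] by simp
  note red = comp_reduce[OF eq[folded X_def]]
  have "\<chi> \<cdot> flat_unit B X = Id C X"
    by (rule monic_cancel[OF k, of _ X]) (use red[of "flat_unit B X"] in simp_all)
  moreover have "\<chi> \<cdot> flat_mult B X = \<chi> \<cdot> flat_map B \<chi>"
  proof (rule monic_cancel[OF k, of _ "flat B (flat B X)"])
    let ?\<kappa> = "ker (retraction B X)" and ?\<kappa>' = "ker (retraction B (flat B X))"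
    \<comment> \<open>After \<open>k\<close>, both sides of the associativity law become
      \<open>copair s (k \<cdot> \<chi>) \<cdot> ?\<kappa>'\<close>.\<close>
    have "k \<cdot> (\<chi> \<cdot> flat_mult B X) = (copair s k \<cdot> copair (inj1 B X) ?\<kappa>) \<cdot> ?\<kappa>'"
      using red[of "flat_mult B X"] ker_flat_mult[OF B X] by simp
    also have "copair s k \<cdot> copair (inj1 B X) ?\<kappa> = copair s (k \<cdot> \<chi>)"
      by (simp add: comp_copair eq)
    also have "\<dots> = copair s k \<cdot> sum_map B \<chi>" by simp
    also have "\<dots> \<cdot> ?\<kappa>' = k \<cdot> (\<chi> \<cdot> flat_map B \<chi>)"
      using red[of "flat_map B \<chi>"] ker_flat_map[of B \<chi> X] by (simp del: copair_sum_map)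
    finally show "k \<cdot> (\<chi> \<cdot> flat_mult B X) = k \<cdot> (\<chi> \<cdot> flat_map B \<chi>)" .
  qed simp_all
  ultimately show ?thesis by (simp add: action_def)
qed

text \<open>Normality is what brings conjugates back into \<open>k\<close>: with
  \<open>X = Dom C k\<close>, the composite of \<open>f\<close> with \<open>copair s k\<close> is
  \<open>(f \<cdot> s) \<cdot> retraction B X\<close>, which vanishes on
  \<open>flat B X\<close>.\<close>

lemma conjugation_exists:
  assumes k: "kernel f k" and s: "s \<in> hom B (Cod C k)"
  obtains \<chi> where "\<chi> \<in> hom (flat B (Dom C k)) (Dom C k)"
    "k \<cdot> \<chi> = copair s k \<cdot> ker (retraction B (Dom C k))"
proof -
  define X where "X = Dom C k"
  have [simp]: "B \<in> Obj C" using s by auto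
  note [simp] = kernel_hom(1-3)[OF k] s[simplified kernel_hom(3)[OF k], simplified] X_def[symmetric]
  have [simp]: "X \<in> Obj C" using Dom_Obj[OF kernel_hom(2)[OF k]] by simp
  let ?\<kappa> = "ker (retraction B X)"
  have "f \<cdot> copair s k = (f \<cdot> s) \<cdot> retraction B X"
    using kernel_hom(4)[OF k] by (simp add: retraction_def comp_copair)
  then have "f \<cdot> (copair s k \<cdot> ?\<kappa>) = ((f \<cdot> s) \<cdot> retraction B X) \<cdot> ?\<kappa>"
    using comp_reduce[of f "copair s k" _ ?\<kappa>] by simp
  then have "f \<cdot> (copair s k \<cdot> ?\<kappa>) = zero (flat B X) (Cod C f)" by simp
  then obtain \<chi> where "\<chi> \<in> hom (flat B X) X" "k \<cdot> \<chi> = copair s k \<cdot> ?\<kappa>"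
    using kernel_lift[OF k, of "copair s k \<cdot> ?\<kappa>" "flat B X"] by auto
  then show thesis using that by simp
qed

text \<open>A converse of \<open>conjugation_exists\<close>, where \<open>s\<close> is the identity.
  The arrow with kernel \<open>m\<close> is the coequaliser \<open>c\<close> of
  \<open>[1, m]\<close> and \<open>[1, 0]\<close>, a reflexive pair with section
  \<open>inj1\<close>. An element \<open>a\<close> killed by \<open>c\<close> is identified with
  zero, so on a cover \<open>a = [1, m] w\<close> with \<open>[1, 0] w = 0\<close>; such a
  \<open>w\<close> lies in \<open>A\<flat>H\<close>, where \<open>[1, m]\<close> takes values in
  \<open>m\<close> by assumption.\<close>

lemma conjugation_stable_normal:
  assumes m: "monic m" and \<chi>: "\<chi> \<in> hom (flat (Cod C m) (Dom C m)) (Dom C m)"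
    and eq: "m \<cdot> \<chi> = copair (Id C (Cod C m)) m \<cdot> ker (retraction (Cod C m) (Dom C m))"
  shows "normal_subobject m (Cod C m)"
proof -
  define A H where "A = Cod C m" and "H = Dom C m"
  have [simp]: "m \<in> Arr C" "Cod C m = A" "Dom C m = H" using monic_Arr[OF m] A_def H_def by simp_all
  have [simp]: "A \<in> Obj C" "H \<in> Obj C" using Dom_Obj[of m] Cod_Obj[of m] by simp_all
  note [simp] = \<chi>[simplified]
  let ?u = "copair (Id C A) m" and ?v = "retraction A H"
  obtain c where c: "coequalizer ?u ?v c"
    and cov: "\<And>W x y. \<lbrakk>x \<in> hom W A; y \<in> hom W A; c \<cdot> x = c \<cdot> y\<rbrakk> \<Longrightarrow>
      \<exists>W' e w. regular_epi e \<and> e \<in> hom W' W \<and> w \<in> hom W' (coprod A H) \<and> ?u \<cdot> w = x \<cdot> e \<and> ?v \<cdot> w = y \<cdot> e"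
    by (rule reflexive_pair_coequalizer[of ?u "coprod A H" A ?v "inj1 A H"]) auto
  have [simp]: "c \<in> Arr C" "Dom C c = A" and cuv: "c \<cdot> ?u = c \<cdot> ?v"
    using c by (auto simp: coequalizer_def)
  have "kernel c m"
  proof (rule kernelI[OF _ m])
    show "c \<cdot> m = zero (Dom C m) (Cod C c)"
      using comp_reduce[OF cuv, of "inj2 A H"] by simp
    fix W a assume "a \<in> hom W (Dom C c)" and ca: "c \<cdot> a = zero W (Cod C c)"
    then have a: "a \<in> hom W A" and W [simp]: "W \<in> Obj C" by auto
    note [simp] = a[simplified]
    obtain W' e w where e: "regular_epi e" "e \<in> hom W' W" and w: "w \<in> hom W' (coprod A H)"
      and uw: "?u \<cdot> w = a \<cdot> e" and vw: "?v \<cdot> w = zero W A \<cdot> e"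
      using cov[OF a, of "zero W A"] ca by auto
    note [simp] = e(2)[simplified]
    obtain w' where w': "w' \<in> hom W' (flat A H)" "ker ?v \<cdot> w' = w"
      by (rule ker_retraction_lift[of A H w W']) (use w vw in auto)
    have "a \<cdot> e = m \<cdot> (\<chi> \<cdot> w')"
      using comp_reduce[OF eq, of w'] w' uw by simp
    then obtain t where "t \<in> hom W H" "m \<cdot> t = a"
      using regular_epi_monic_factor[OF e(1) m, of a "\<chi> \<cdot> w'"] w' by auto
    then show "\<exists>t\<in>hom W (Dom C m). m \<cdot> t = a" by auto
  qed simp_all
  then show ?thesis using m unfolding normal_subobject_def subobject_def by auto
qed

lemma characteristic_in_kernel_normal:
  assumes h: "characteristic h (Dom C k)" and k: "kernel p k"
  shows "normal_subobject (k \<cdot> h) (Cod C k)"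
proof -
  define A G H where "A = Cod C k" and "G = Dom C k" and "H = Dom C h"
  have mh: "monic h" and Gh: "Cod C h = G"
    using h unfolding characteristic_def subobject_def G_def by auto
  have [simp]: "h \<in> Arr C" "Cod C h = G" "Dom C h = H" "k \<in> Arr C" "Cod C k = A" "Dom C k = G"
    "Dom C p = A"
    using monic_Arr[OF mh] Gh kernel_hom[OF k] A_def G_def H_def by simp_all
  have [simp]: "A \<in> Obj C" "G \<in> Obj C" "H \<in> Obj C"
    using Dom_Obj[of h] Dom_Obj[of k] Cod_Obj[of k] by simp_all
  obtain \<chi> where \<chi>: "\<chi> \<in> hom (flat A G) G" and eq: "k \<cdot> \<chi> = copair (Id C A) k \<cdot> ker (retraction A G)"
    using conjugation_exists[OF k, of "Id C A" A] by auto
  note [simp] = \<chi>[simplified]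
  have "action A G \<chi>"
    using conjugation_action[OF kernel_monic[OF k], of "Id C A" A \<chi>] eq by simp
  then have "\<exists>!\<chi>'. action A H \<chi>' \<and> h \<cdot> \<chi>' = \<chi> \<cdot> flat_map A h"
    using h unfolding characteristic_def by simp
  then obtain \<chi>' where "action A H \<chi>'" and eq': "h \<cdot> \<chi>' = \<chi> \<cdot> flat_map A h"
    by blast
  then have [simp]: "\<chi>' \<in> Arr C" "Dom C \<chi>' = flat A H" "Cod C \<chi>' = H" by (auto simp: action_def)
  \<comment> \<open>Naturality of the inclusion of \<open>A\<flat>H\<close> into
    \<open>A + H\<close> moves \<open>h\<close> inside, turning conjugation on \<open>k\<close> into
    conjugation on \<open>k \<cdot> h\<close>.\<close>
  have "(k \<cdot> h) \<cdot> \<chi>' = copair (Id C A) k \<cdot> (ker (retraction A G) \<cdot> flat_map A h)"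
    using comp_reduce[OF eq, of "flat_map A h"] by (simp add: eq')
  also have "\<dots> = (copair (Id C A) k \<cdot> sum_map A h) \<cdot> ker (retraction A H)"
    using ker_flat_map[of A h G] by (simp del: copair_sum_map)
  also have "\<dots> = copair (Id C A) (k \<cdot> h) \<cdot> ker (retraction A H)" by simp
  finally show ?thesis
    using conjugation_stable_normal[of "k \<cdot> h" \<chi>'] monic_comp[OF mh kernel_monic[OF k]] by simp
qed

text \<open>The semidirect product is the quotient of \<open>B + G\<close> by the reflexive pair \<open>1 + \<xi>\<close>,
  \<open>[\<iota>\<^sub>1, \<kappa>]\<close> on \<open>B + B\<flat>G\<close>; the associativity of \<open>\<xi>\<close> is what makes \<open>G\<close> embed in it.\<close>

lemma semidirect_product:
  assumes act: "action B G \<xi>"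
  obtains p s k where "point B p s" "kernel p k" "Dom C k = G" "Cod C k = Dom C p"
    "copair s k \<cdot> ker (retraction B G) = k \<cdot> \<xi>"
proof -
  have B [simp]: "B \<in> Obj C" and G [simp]: "G \<in> Obj C"
    and [simp]: "\<xi> \<in> Arr C" "Dom C \<xi> = flat B G" "Cod C \<xi> = G"
    and unit: "\<xi> \<cdot> flat_unit B G = Id C G" and mult: "\<xi> \<cdot> flat_mult B G = \<xi> \<cdot> flat_map B \<xi>"
    using act by (auto simp: action_def)
  let ?X = "coprod B (flat B G)" and ?Y = "coprod B G" and ?\<kappa> = "ker (retraction B G)"
    and ?\<kappa>' = "ker (retraction B (flat B G))" and ?\<eta> = "flat_unit B G"
  let ?u = "sum_map B \<xi>" and ?v = "copair (inj1 B G) ?\<kappa>" and ?t = "sum_map B ?\<eta>"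
  \<comment> \<open>\<open>?t\<close> is a common section of the pair: for \<open>?u\<close> by the
    unit law of \<open>\<xi>\<close>, for \<open>?v\<close> because
    \<open>?\<kappa> \<cdot> ?\<eta>\<close> is the second injection.\<close>
  have ut: "?u \<cdot> ?t = Id C ?Y"
    by (rule coprod_eqI[OF B G, of _ ?Y])
      (use comp_reduce[OF sum_map_inj(2)[of B \<xi> "flat B G"], of ?\<eta>] unit in simp_all)
  have vt: "?v \<cdot> ?t = Id C ?Y"
    by (rule coprod_eqI[OF B G, of _ ?Y]) (simp_all)
  have ru: "retraction B G \<cdot> ?u = retraction B (flat B G)" by simp
  have rv: "retraction B G \<cdot> ?v = retraction B (flat B G)"
    by (simp add: comp_copair retraction_def[of B "flat B G"])
  obtain c where c: "coequalizer ?u ?v c" and rc: "regular_epi c"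
    and cov: "\<And>W x y. \<lbrakk>x \<in> hom W ?Y; y \<in> hom W ?Y; c \<cdot> x = c \<cdot> y\<rbrakk> \<Longrightarrow>
      \<exists>W' e w. regular_epi e \<and> e \<in> hom W' W \<and> w \<in> hom W' ?X \<and> ?u \<cdot> w = x \<cdot> e \<and> ?v \<cdot> w = y \<cdot> e"
    by (rule reflexive_pair_coequalizer[of ?u ?X ?Y ?v ?t]) (use ut vt in auto)
  have [simp]: "c \<in> Arr C" "Dom C c = ?Y" and cuv: "c \<cdot> ?u = c \<cdot> ?v"
    using c by (auto simp: coequalizer_def)
  \<comment> \<open>Both legs commute with the retractions to \<open>B\<close>, so
    \<open>retraction B G\<close> descends to the quotient.\<close>
  obtain p where p: "p \<in> hom (Cod C c) B" and pc: "p \<cdot> c = retraction B G"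
    using coequalizer_factor[OF c, of "retraction B G" B] ru rv by auto
  note [simp] = p[simplified]
  define s k where "s = c \<cdot> inj1 B G" and "k = c \<cdot> inj2 B G"
  have [simp]: "s \<in> Arr C" "Dom C s = B" "Cod C s = Cod C c"
    "k \<in> Arr C" "Dom C k = G" "Cod C k = Cod C c" by (simp_all add: s_def k_def)
  have "point B p s"
    using comp_reduce[OF pc, of "inj1 B G"] by (simp add: point_def s_def)
  moreover have k\<xi>: "c \<cdot> ?\<kappa> = k \<cdot> \<xi>"
    using comp_reduce[OF cuv, of "inj2 B (flat B G)"] by (simp add: k_def)
  moreover have "copair s k = c"
    by (rule coprod_eqI[OF B G, of _ "Cod C c"]) (simp_all add: s_def k_def)
  moreover have "monic k"
    unfolding monic_def
  proof (intro conjI allI ballI impI)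
    fix W x y assume x: "x \<in> hom W (Dom C k)" and y: "y \<in> hom W (Dom C k)" and kxy: "k \<cdot> x = k \<cdot> y"
    note [simp] = x[simplified] y[simplified]
    \<comment> \<open>If \<open>k\<close> identifies \<open>x\<close> and \<open>y\<close>, then
      \<open>c\<close> identifies their images under \<open>inj2 B G\<close>, so on a cover both
      come from one \<open>w\<close> in \<open>B + B\<flat>G\<close>. Its retraction to
      \<open>B\<close> is zero, which puts it in \<open>B\<flat>(B\<flat>G)\<close>. There
      \<open>flat_map B \<xi>\<close> takes it to \<open>x\<close> and \<open>flat_mult B G\<close>
      to \<open>y\<close>, both up to the unit, and associativity says that \<open>\<xi>\<close>
      does not distinguish the two values.\<close>
    have "\<exists>W' e w. regular_epi e \<and> e \<in> hom W' W \<and> w \<in> hom W' ?X \<and>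
        ?u \<cdot> w = (inj2 B G \<cdot> x) \<cdot> e \<and> ?v \<cdot> w = (inj2 B G \<cdot> y) \<cdot> e"
      by (rule cov) (use kxy in \<open>simp_all add: k_def\<close>)
    then obtain W' e w where e: "regular_epi e" "e \<in> hom W' W" and w: "w \<in> hom W' ?X"
      and uw: "?u \<cdot> w = (inj2 B G \<cdot> x) \<cdot> e" and vw: "?v \<cdot> w = (inj2 B G \<cdot> y) \<cdot> e"
      by blast
    have [simp]: "W' \<in> Obj C" using e(2) by auto
    note [simp] = e(2)[simplified] w[simplified]
    have "retraction B (flat B G) \<cdot> w = retraction B G \<cdot> (?u \<cdot> w)"
      using comp_reduce[OF ru, of w] by simp
    also have "\<dots> = zero W' B"
      unfolding uw using comp_reduce[OF retraction_hom(5)[OF B G], of "x \<cdot> e"] by simp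
    finally obtain w' where w': "w' \<in> hom W' (flat B (flat B G))" and kw: "?\<kappa>' \<cdot> w' = w"
      using ker_retraction_lift[of B "flat B G" w W'] by auto
    note [simp] = w'[simplified]
    note red = comp_reduce[OF flat_unit_hom(4)[OF B G]]
    have 1: "flat_map B \<xi> \<cdot> w' = ?\<eta> \<cdot> (x \<cdot> e)"
      by (rule ker_retraction_cancel[OF B G, of _ W'])
        (use comp_reduce[OF ker_flat_map[of B \<xi> G], of w'] red[of "x \<cdot> e"] uw kw in simp_all)
    have 2: "flat_mult B G \<cdot> w' = ?\<eta> \<cdot> (y \<cdot> e)"
      by (rule ker_retraction_cancel[OF B G, of _ W'])
        (use comp_reduce[OF ker_flat_mult[OF B G], of w'] red[of "y \<cdot> e"] vw kw in simp_all)
    have "x \<cdot> e = \<xi> \<cdot> (?\<eta> \<cdot> (x \<cdot> e))" using comp_reduce[OF unit, of "x \<cdot> e"] by simp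
    also have "\<dots> = \<xi> \<cdot> (?\<eta> \<cdot> (y \<cdot> e))"
      unfolding 1[symmetric] 2[symmetric] using comp_reduce[OF mult, of w'] by simp
    also have "\<dots> = y \<cdot> e" using comp_reduce[OF unit, of "y \<cdot> e"] by simp
    finally show "x = y" using regular_epi_cancel[OF e(1), of x G y] by simp
  qed simp
  moreover from this have "kernel p k"
  proof (rule kernelI[rotated])
    show "p \<cdot> k = zero (Dom C k) (Cod C p)"
      using comp_reduce[OF pc, of "inj2 B G"] by (simp add: k_def)
    fix W a assume a: "a \<in> hom W (Dom C p)" and pa: "p \<cdot> a = zero W (Cod C p)"
    have [simp]: "W \<in> Obj C" using a by auto
    note [simp] = a[simplified]
    \<comment> \<open>Lifted along \<open>c\<close> on a cover, \<open>a\<close> becomes an element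
      of \<open>B + G\<close> killed by the retraction, hence one of \<open>B\<flat>G\<close>, on
      which \<open>c\<close> acts as \<open>k \<cdot> \<xi>\<close>.\<close>
    obtain W' e w where e: "regular_epi e" "e \<in> hom W' W" and w: "w \<in> hom W' ?Y" and cw: "c \<cdot> w = a \<cdot> e"
      by (rule regular_epi_cover[OF rc, of a W]) auto
    have [simp]: "W' \<in> Obj C" using e(2) by auto
    note [simp] = e(2)[simplified] w[simplified]
    have "retraction B G \<cdot> w = zero W' B"
      using comp_reduce[OF pc, of w] comp_reduce[OF pa, of e] cw by simp
    then obtain w' where w': "w' \<in> hom W' (flat B G)" "?\<kappa> \<cdot> w' = w"
      using ker_retraction_lift[of B G w W'] by auto
    have "a \<cdot> e = k \<cdot> (\<xi> \<cdot> w')"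
      using comp_reduce[OF k\<xi>, of w'] cw w' by simp
    then obtain t where "t \<in> hom W G" "k \<cdot> t = a"
      using regular_epi_monic_factor[OF e(1) \<open>monic k\<close>, of a "\<xi> \<cdot> w'"] w' by auto
    then show "\<exists>t\<in>hom W (Dom C k). k \<cdot> t = a" by auto
  qed simp_all
  ultimately show thesis using that[of p s k] by simp
qed

subsection \<open>Commutators and centralisers\<close>

text \<open>The diagonal \<open>d\<close> of the kernel pair is a morphism of points over
  \<open>Dom C f\<close>, from the identity point to \<open>(s, d)\<close>. The fibre of
  \<open>s\<close> over zero is a copy of the kernel of \<open>f\<close>, hence zero, so
  \<open>d\<close> becomes invertible after change of base along the zero arrow. By protomodularity
  \<open>d\<close> is itself invertible, and the two projections coincide.\<close>

lemma zero_kernel_monic: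
  assumes k: "kernel f k" and Z: "zero_object (Dom C k)"
  shows "monic f"
proof -
  define X Z where "X = Dom C f" and "Z = Dom C k"
  have [simp]: "f \<in> Arr C" "Dom C f = X" "k \<in> Arr C" "Dom C k = Z" "Cod C k = X"
    using kernel_hom[OF k] X_def Z_def by simp_all
  have [simp]: "X \<in> Obj C" "Z \<in> Obj C" using Dom_Obj[of f] Dom_Obj[of k] by simp_all
  have zZ: "zero_object Z" using Z by simp
  obtain r s where R: "pullback f f r s" using pullback_exists[of f f] by auto
  note [simp] = pullback_hom(4,5,6,7,8)[OF R, simplified] and req = pullback_hom(9)[OF R]
  obtain d where [simp]: "d \<in> Arr C" "Dom C d = X" "Cod C d = Dom C r"
    and d [simp]: "r \<cdot> d = Id C X" "s \<cdot> d = Id C X"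
    by (rule pullback_lift[OF R, of "Id C X" X "Id C X"]) auto
  note red = comp_reduce[OF d(1)] comp_reduce[OF d(2)]
  let ?v = "zero Z X"
  have "point_morphism X (Id C X) (Id C X) s d d"
    by (simp add: point_morphism_def point_def)
  moreover have "pullback (Id C X) ?v ?v (Id C Z)"
    by (rule pullbackI) auto
  moreover have "pullback s ?v (d \<cdot> ?v) (Id C Z)"
  proof (rule pullbackI)
    fix W a b assume a: "a \<in> hom W (Dom C s)" and b: "b \<in> hom W (Dom C ?v)" and eq: "s \<cdot> a = ?v \<cdot> b"
    have [simp]: "W \<in> Obj C" using a by auto
    note [simp] = a[simplified] b[simplified]
    have sa: "s \<cdot> a = zero W X" using eq by simp
    have "f \<cdot> (r \<cdot> a) = zero W (Cod C f)"
      using comp_reduce[OF req, of a] sa by simp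
    then obtain z where z: "z \<in> hom W Z" "k \<cdot> z = r \<cdot> a"
      using kernel_lift[OF k, of "r \<cdot> a" W] by auto
    have "z = zero W Z" by (rule arrow_to_zero_object[OF zZ z(1)])
    then have ra: "r \<cdot> a = zero W X" using z(2) by simp
    have "(d \<cdot> ?v) \<cdot> b = a"
      by (rule pullback_eqI[OF R, of _ W]) (use ra sa in simp_all)
    then show "\<exists>u\<in>hom W (Dom C (d \<cdot> ?v)). (d \<cdot> ?v) \<cdot> u = a \<and> Id C Z \<cdot> u = b"
      by (intro bexI[of _ b]) simp_all
  qed (auto simp: red)
  moreover have "Id C Z \<in> hom (Dom C ?v) (Dom C (d \<cdot> ?v))" "(d \<cdot> ?v) \<cdot> Id C Z = d \<cdot> ?v"
    "Id C Z \<cdot> Id C Z = Id C Z" "iso (Id C Z)"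
    by (simp_all add: iso_Id)
  ultimately have "iso d"
    by (intro protomodular[unfolded protomodular_def, rule_format,
        of X "Id C X" "Id C X" s d d ?v ?v "Id C Z" "d \<cdot> ?v" "Id C Z" "Id C Z"] conjI)
  then obtain t where [simp]: "t \<in> Arr C" "Dom C t = Dom C r" "Cod C t = X" and t: "d \<cdot> t = Id C (Dom C r)"
    by (auto simp: iso_def)
  have rs: "r = s"
  proof -
    have "r \<cdot> (d \<cdot> t) = t" "s \<cdot> (d \<cdot> t) = t"
      using red(1)[of t] red(2)[of t] by simp_all
    moreover have "r \<cdot> (d \<cdot> t) = r" "s \<cdot> (d \<cdot> t) = s" unfolding t by simp_all
    ultimately show ?thesis by metis
  qed
  show ?thesis
    unfolding monic_def
  proof (intro conjI allI ballI impI)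
    fix W x y assume x: "x \<in> hom W (Dom C f)" and y: "y \<in> hom W (Dom C f)" and eq: "f \<cdot> x = f \<cdot> y"
    obtain w where "r \<cdot> w = x" "s \<cdot> w = y"
      by (rule pullback_lift[OF R x y eq]) auto
    then show "x = y" using rs by simp
  qed simp
qed

text \<open>Every object is a point over a zero object, and the product is the pullback of two such
  points; its injections are the canonical sections of
  \<open>point_pullback_extremal\<close>.\<close>

lemma product_injections_extremal:
  assumes H: "H \<in> Obj C" and K: "K \<in> Obj C" and m: "monic m" "Cod C m = prod H K"
    and i: "i \<in> hom H (Dom C m)" "m \<cdot> i = pair (Id C H) (zero H K)"
    and j: "j \<in> hom K (Dom C m)" "m \<cdot> j = pair (zero K H) (Id C K)"
  shows "iso m"
proof -
  obtain Z where Z: "zero_object Z" using pointed unfolding pointed_def by blast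
  note [simp] = H K zero_object_Obj[OF Z]
  have "zero Z Z = Id C Z" by (rule arrow_to_zero_object[OF Z, symmetric]) simp
  then have pt: "point Z (zero X Z) (zero Z X)" if "X \<in> Obj C" for X
    using that by (simp add: point_def)
  have "pullback (zero H Z) (zero K Z) (proj1 H K) (proj2 H K)"
  proof (rule pullbackI)
    fix W a b assume "a \<in> hom W (Dom C (zero H Z))" "b \<in> hom W (Dom C (zero K Z))"
    then show "\<exists>u\<in>hom W (Dom C (proj1 H K)). proj1 H K \<cdot> u = a \<and> proj2 H K \<cdot> u = b"
      by (intro bexI[of _ "pair a b"]) auto
  next
    fix W u v assume "u \<in> hom W (Dom C (proj1 H K))" "v \<in> hom W (Dom C (proj1 H K))"
      "proj1 H K \<cdot> u = proj1 H K \<cdot> v" "proj2 H K \<cdot> u = proj2 H K \<cdot> v"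
    then show "u = v" by (intro prod_eqI[of H K u W v]) simp_all
  qed simp_all
  from point_pullback_extremal[OF pt[OF H] pt[OF K] this m(1), of i j] show ?thesis
    using m i j by simp
qed

text \<open>The pullback of \<open>m\<close> along \<open>\<phi>\<close> is a subobject of the
  product containing both injections, hence all of it.\<close>

lemma product_factor:
  assumes H: "H \<in> Obj C" and K: "K \<in> Obj C" and \<phi>: "\<phi> \<in> hom (prod H K) (Cod C m)" and m: "monic m"
    and i: "i \<in> hom H (Dom C m)" "\<phi> \<cdot> pair (Id C H) (zero H K) = m \<cdot> i"
    and j: "j \<in> hom K (Dom C m)" "\<phi> \<cdot> pair (zero K H) (Id C K) = m \<cdot> j"
  obtains t where "t \<in> hom (prod H K) (Dom C m)" "m \<cdot> t = \<phi>"
proof -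
  note [simp] = H K \<phi>[simplified] monic_Arr[OF m]
  obtain a b where P: "pullback \<phi> m a b" using pullback_exists[of \<phi> m] by auto
  note [simp] = pullback_hom(4,5,6,7,8)[OF P, simplified]
  obtain i' where i': "i' \<in> hom H (Dom C a)" "a \<cdot> i' = pair (Id C H) (zero H K)"
    by (rule pullback_lift[OF P _ i]) auto
  obtain j' where j': "j' \<in> hom K (Dom C a)" "a \<cdot> j' = pair (zero K H) (Id C K)"
    by (rule pullback_lift[OF P _ j]) auto
  have "iso a"
    by (rule product_injections_extremal[OF H K pullback_monic[OF P m] _ i' j']) simp
  then obtain t where t: "t \<in> hom (prod H K) (Dom C a)" "a \<cdot> t = Id C (prod H K)"
    by (auto simp: iso_def)
  have "m \<cdot> (b \<cdot> t) = \<phi>"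
    using comp_reduce[OF pullback_hom(9)[OF P], of t] t by simp
  with t show thesis by (intro that[of "b \<cdot> t"]) simp_all
qed

text \<open>Agreement is factorisation through the diagonal: \<open>pair f g\<close> factors through
  it on each injection, so \<open>product_factor\<close> makes it factor on the whole
  product.\<close>

lemma product_arrow_eqI:
  assumes H: "H \<in> Obj C" and K: "K \<in> Obj C" and f: "f \<in> hom (prod H K) X" and g: "g \<in> hom (prod H K) X"
    and eq: "f \<cdot> pair (Id C H) (zero H K) = g \<cdot> pair (Id C H) (zero H K)"
      "f \<cdot> pair (zero K H) (Id C K) = g \<cdot> pair (zero K H) (Id C K)"
  shows "f = g"
proof -
  have [simp]: "X \<in> Obj C" using f by auto
  note [simp] = H K f[simplified] g[simplified]
  let ?\<Delta> = "pair (Id C X) (Id C X)"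
  have \<Delta>: "monic ?\<Delta>" by (rule pair_monic) (simp_all add: parallel_def)
  have P [simp]: "proj1 X X \<cdot> ?\<Delta> = Id C X" "proj2 X X \<cdot> ?\<Delta> = Id C X"
    "proj1 X X \<cdot> pair f g = f" "proj2 X X \<cdot> pair f g = g" by simp_all
  note red = P[THEN comp_reduce]
  have *: "pair f g \<cdot> x = ?\<Delta> \<cdot> (g \<cdot> x)"
    if "x \<in> hom W (prod H K)" "f \<cdot> x = g \<cdot> x" for x W
    by (rule prod_eqI[of X X _ W]) (use that red in simp_all)
  obtain t where t: "t \<in> hom (prod H K) X" "?\<Delta> \<cdot> t = pair f g"
  proof (rule product_factor[OF H K _ \<Delta>, of "pair f g"])
    show "pair f g \<cdot> pair (Id C H) (zero H K) = ?\<Delta> \<cdot> (g \<cdot> pair (Id C H) (zero H K))"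
      by (rule *[of _ H]) (use eq in simp_all)
    show "pair f g \<cdot> pair (zero K H) (Id C K) = ?\<Delta> \<cdot> (g \<cdot> pair (zero K H) (Id C K))"
      by (rule *[of _ K]) (use eq in simp_all)
  qed simp_all
  have "f = t" using red(1)[of t] t by simp
  also have "t = g" using red(2)[of t] t by simp
  finally show "f = g" .
qed

text \<open>\<open>\<phi>\<close> is the cooperator of \<open>h\<close> and \<open>k\<close>, unique
  by \<open>product_arrow_eqI\<close>. This form of commuting mentions no pushout and so passes
  along arrows out of the ambient object.\<close>

definition cooperating :: "'m \<Rightarrow> 'm \<Rightarrow> bool" where
  "cooperating h k \<longleftrightarrow> (\<exists>\<phi> \<in> hom (prod (Dom C h) (Dom C k)) (Cod C h).
    \<phi> \<cdot> pair (Id C (Dom C h)) (zero (Dom C h) (Dom C k)) = h \<and>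
    \<phi> \<cdot> pair (zero (Dom C k) (Dom C h)) (Id C (Dom C k)) = k)"

lemma cooperatingE:
  assumes "cooperating h k" "Dom C h = H" "Dom C k = K"
  obtains \<phi> where "\<phi> \<in> hom (prod H K) (Cod C h)" "\<phi> \<cdot> pair (Id C H) (zero H K) = h"
    "\<phi> \<cdot> pair (zero K H) (Id C K) = k"
  using assms unfolding cooperating_def by blast

section \<open>Huq commutators in terms of cooperators\<close>

lemma Sigma_map_hom [simp]:
  assumes "H \<in> Obj C" "K \<in> Obj C"
  shows "Sigma_map H K \<in> Arr C" "Dom C (Sigma_map H K) = coprod H K" "Cod C (Sigma_map H K) = prod H K"
  using assms by (simp_all add: Sigma_map_def)

lemma Sigma_map_inj [simp]:
  assumes "H \<in> Obj C" "K \<in> Obj C"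
  shows "Sigma_map H K \<cdot> inj1 H K = pair (Id C H) (zero H K)"
    "Sigma_map H K \<cdot> inj2 H K = pair (zero K H) (Id C K)"
proof -
  note [simp] = assms
  have P: "proj1 H K \<cdot> Sigma_map H K = copair (Id C H) (zero K H)"
    "proj2 H K \<cdot> Sigma_map H K = copair (zero H K) (Id C K)"
    by (simp_all add: Sigma_map_def)
  note red = P[THEN comp_reduce]
  show "Sigma_map H K \<cdot> inj1 H K = pair (Id C H) (zero H K)"
    by (rule prod_eqI[of H K _ H]) (simp_all add: red)
  show "Sigma_map H K \<cdot> inj2 H K = pair (zero K H) (Id C K)"
    by (rule prod_eqI[of H K _ K]) (simp_all add: red)
qed

text \<open>If the commutator is zero, \<open>\<pi>\<close> is monic by
  \<open>zero_kernel_monic\<close>, and \<open>w\<close>, which restricts to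
  \<open>\<pi> \<cdot> h\<close> and \<open>\<pi> \<cdot> k\<close> on the injections, factors
  through it; the factor is the cooperator. Conversely, a cooperator gives a pushout square in which
  \<open>\<pi>\<close> is the identity, with zero kernel.\<close>

lemma huq_commutator_zero_iff:
  assumes h: "h \<in> Arr C" and k: "k \<in> Arr C" and hk: "Cod C k = Cod C h"
  shows "huq_commutator_zero h k \<longleftrightarrow> cooperating h k"
proof
  define H K G where "H = Dom C h" and "K = Dom C k" and "G = Cod C h"
  have [simp]: "h \<in> Arr C" "k \<in> Arr C" "Dom C h = H" "Dom C k = K" "Cod C h = G" "Cod C k = G"
    using assms H_def K_def G_def by simp_all
  have [simp]: "H \<in> Obj C" "K \<in> Obj C" "G \<in> Obj C"
    using Dom_Obj[OF h] Dom_Obj[OF k] Cod_Obj[OF h] by simp_all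
  let ?\<Sigma> = "Sigma_map H K" and ?i = "pair (Id C H) (zero H K)" and ?j = "pair (zero K H) (Id C K)"
  {
    assume "huq_commutator_zero h k"
    then obtain w \<pi> c where po: "pushout ?\<Sigma> (copair h k) w \<pi>" and c: "kernel \<pi> c" "zero_object (Dom C c)"
      unfolding huq_commutator_zero_def huq_commutator_def by auto
    have [simp]: "w \<in> Arr C" "Dom C w = prod H K" "\<pi> \<in> Arr C" "Dom C \<pi> = G" "Cod C \<pi> = Cod C w"
      and eq: "w \<cdot> ?\<Sigma> = \<pi> \<cdot> copair h k"
      using po by (auto simp: pushout_def)
    have \<pi>: "monic \<pi>" by (rule zero_kernel_monic[OF c])
    have w: "w \<cdot> ?i = \<pi> \<cdot> h" "w \<cdot> ?j = \<pi> \<cdot> k"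
      using comp_reduce[OF eq, of "inj1 H K"] comp_reduce[OF eq, of "inj2 H K"] by simp_all
    obtain \<phi> where \<phi>: "\<phi> \<in> hom (prod H K) G" "\<pi> \<cdot> \<phi> = w"
      by (rule product_factor[of H K w \<pi> h k]) (use w \<pi> in auto)
    have "\<phi> \<cdot> ?i = h"
      by (rule monic_cancel[OF \<pi>, of _ H]) (use comp_reduce[OF \<phi>(2), of ?i] \<phi>(1) w in simp_all)
    moreover have "\<phi> \<cdot> ?j = k"
      by (rule monic_cancel[OF \<pi>, of _ K]) (use comp_reduce[OF \<phi>(2), of ?j] \<phi>(1) w in simp_all)
    ultimately show "cooperating h k" using \<phi>(1) by (auto simp: cooperating_def)
  }
  {
    assume "cooperating h k"
    then obtain \<phi> where "\<phi> \<in> hom (prod H K) (Cod C h)" and \<phi>: "\<phi> \<cdot> ?i = h" "\<phi> \<cdot> ?j = k"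
      by (rule cooperatingE) simp_all
    then have [simp]: "\<phi> \<in> Arr C" "Dom C \<phi> = prod H K" "Cod C \<phi> = G" by simp_all
    have \<phi>\<Sigma>: "\<phi> \<cdot> ?\<Sigma> = copair h k"
      by (rule coprod_eqI[of H K _ G]) (use \<phi> in simp_all)
    have "pushout ?\<Sigma> (copair h k) \<phi> (Id C G)"
      unfolding pushout_def
    proof (intro conjI allI ballI impI)
      fix W a b assume a: "a \<in> hom (Cod C ?\<Sigma>) W" and b: "b \<in> hom (Cod C (copair h k)) W"
        and eq: "a \<cdot> ?\<Sigma> = b \<cdot> copair h k"
      note [simp] = a[simplified] b[simplified]
      \<comment> \<open>On the injections both arrows are \<open>b \<cdot> h\<close> and
        \<open>b \<cdot> k\<close>, so \<open>b\<close>, the only candidate, is the mediating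
        arrow.\<close>
      have "b \<cdot> \<phi> = a"
        by (rule product_arrow_eqI[of H K _ W])
          (use \<phi> comp_reduce[OF eq, of "inj1 H K"] comp_reduce[OF eq, of "inj2 H K"] in simp_all)
      then show "\<exists>!u. u \<in> hom (Cod C \<phi>) W \<and> u \<cdot> \<phi> = a \<and> u \<cdot> Id C G = b"
        by (intro ex1I[of _ b]) (simp, metis comp_Id_right mem_hom_iff \<open>Cod C \<phi> = G\<close>)
    qed (use \<phi>\<Sigma> in simp_all)
    moreover obtain Z where Z: "zero_object Z" using pointed unfolding pointed_def by blast
    note [simp] = zero_object_Obj[OF Z]
    have "kernel (Id C G) (zero Z G)"
    proof (rule kernelI)
      show "monic (zero Z G)"
        unfolding monic_def using zero_object_arrow_unique(1)[OF Z] by simp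
      show "\<exists>u\<in>hom W (Dom C (zero Z G)). zero Z G \<cdot> u = a"
        if "a \<in> hom W (Dom C (Id C G))" "Id C G \<cdot> a = zero W (Cod C (Id C G))" for W a
      proof -
        have "W \<in> Obj C" using hom_Obj[OF that(1)] by simp
        with that show ?thesis by (intro bexI[of _ "zero W Z"]) simp_all
      qed
    qed simp_all
    ultimately have "huq_commutator h k (zero Z G)" unfolding huq_commutator_def by auto
    with Z show "huq_commutator_zero h k" unfolding huq_commutator_zero_def by auto
  }
qed

lemma cooperating_restrict:
  assumes hk: "cooperating h k" and "h \<in> Arr C" "k \<in> Arr C" and j: "j \<in> Arr C" "Cod C j = Dom C k"
  shows "cooperating h (k \<cdot> j)"
proof -
  define H K J where "H = Dom C h" and "K = Dom C k" and "J = Dom C j"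
  have [simp]: "h \<in> Arr C" "k \<in> Arr C" "j \<in> Arr C" "Dom C h = H" "Dom C k = K" "Dom C j = J" "Cod C j = K"
    using assms H_def K_def J_def by simp_all
  have [simp]: "H \<in> Obj C" "K \<in> Obj C" "J \<in> Obj C"
    using Dom_Obj[of h] Dom_Obj[of k] Dom_Obj[of j] by simp_all
  obtain \<phi> where "\<phi> \<in> hom (prod H K) (Cod C h)"
    and \<phi>: "\<phi> \<cdot> pair (Id C H) (zero H K) = h" "\<phi> \<cdot> pair (zero K H) (Id C K) = k"
    by (rule cooperatingE[OF hk]) simp_all
  then have [simp]: "\<phi> \<in> Arr C" "Dom C \<phi> = prod H K" "Cod C \<phi> = Cod C h" by simp_all
  \<comment> \<open>This is \<open>1 \<times> j\<close>; the new cooperator is \<open>\<phi>\<close>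
    composed with it.\<close>
  let ?j = "pair (proj1 H J) (j \<cdot> proj2 H J)"
  have P: "proj1 H K \<cdot> ?j = proj1 H J" "proj2 H K \<cdot> ?j = j \<cdot> proj2 H J" by simp_all
  note red = P[THEN comp_reduce]
  have 1: "?j \<cdot> pair (Id C H) (zero H J) = pair (Id C H) (zero H K)"
    by (rule prod_eqI[of H K _ H]) (simp_all add: red)
  have Q: "proj1 H K \<cdot> pair (zero K H) (Id C K) = zero K H" "proj2 H K \<cdot> pair (zero K H) (Id C K) = Id C K"
    by simp_all
  note red = red Q[THEN comp_reduce]
  have 2: "?j \<cdot> pair (zero J H) (Id C J) = pair (zero K H) (Id C K) \<cdot> j"
    by (rule prod_eqI[of H K _ J]) (simp_all add: red)
  have "\<phi> \<cdot> ?j \<in> hom (prod H J) (Cod C h)" "(\<phi> \<cdot> ?j) \<cdot> pair (Id C H) (zero H J) = h"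
    "(\<phi> \<cdot> ?j) \<cdot> pair (zero J H) (Id C J) = k \<cdot> j"
    using comp_reduce[OF \<phi>(2), of j] by (simp_all add: 1 2 \<phi>(1))
  then show ?thesis unfolding cooperating_def by (intro bexI[of _ "\<phi> \<cdot> ?j"]) simp_all
qed

lemma cooperating_comp:
  assumes "cooperating h k" "h \<in> Arr C" "k \<in> Arr C" "m \<in> Arr C" "Cod C h = Dom C m"
  shows "cooperating (m \<cdot> h) (m \<cdot> k)"
proof -
  define H K where "H = Dom C h" and "K = Dom C k"
  have [simp]: "h \<in> Arr C" "k \<in> Arr C" "Dom C h = H" "Dom C k = K" "m \<in> Arr C" "Cod C h = Dom C m"
    using assms H_def K_def by simp_all
  have [simp]: "H \<in> Obj C" "K \<in> Obj C" using Dom_Obj[of h] Dom_Obj[of k] by simp_all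
  obtain \<phi> where "\<phi> \<in> hom (prod H K) (Cod C h)"
    and \<phi>: "\<phi> \<cdot> pair (Id C H) (zero H K) = h" "\<phi> \<cdot> pair (zero K H) (Id C K) = k"
    by (rule cooperatingE[OF assms(1)]) simp_all
  then have [simp]: "\<phi> \<in> Arr C" "Dom C \<phi> = prod H K" "Cod C \<phi> = Cod C h" by simp_all
  have [simp]: "Cod C k = Dom C m" using arg_cong[OF \<phi>(2), of "Cod C"] by simp
  have "(m \<cdot> \<phi>) \<cdot> pair (Id C H) (zero H K) = m \<cdot> h" "(m \<cdot> \<phi>) \<cdot> pair (zero K H) (Id C K) = m \<cdot> k"
    using \<phi> by simp_all
  then show ?thesis unfolding cooperating_def by (intro bexI[of _ "m \<cdot> \<phi>"]) simp_all
qed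

text \<open>Commuting does not depend on the ambient object: the cooperator in the larger object
  lands in \<open>m\<close> on both injections, hence on the whole product.\<close>

lemma cooperating_monic_cancel:
  assumes "cooperating (m \<cdot> h) (m \<cdot> k)" "h \<in> Arr C" "k \<in> Arr C" and m: "monic m"
    and "Cod C h = Dom C m" "Cod C k = Dom C m"
  shows "cooperating h k"
proof -
  define H K where "H = Dom C h" and "K = Dom C k"
  have [simp]: "h \<in> Arr C" "k \<in> Arr C" "Dom C h = H" "Dom C k = K" "m \<in> Arr C"
    "Cod C h = Dom C m" "Cod C k = Dom C m"
    using assms monic_Arr H_def K_def by simp_all
  have [simp]: "H \<in> Obj C" "K \<in> Obj C" using Dom_Obj[of h] Dom_Obj[of k] by simp_all
  let ?i = "pair (Id C H) (zero H K)" and ?j = "pair (zero K H) (Id C K)"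
  obtain \<phi> where \<phi>: "\<phi> \<in> hom (prod H K) (Cod C m)" "\<phi> \<cdot> ?i = m \<cdot> h" "\<phi> \<cdot> ?j = m \<cdot> k"
    using cooperatingE[OF assms(1), of H K] by auto
  obtain t where [simp]: "t \<in> Arr C" "Dom C t = prod H K" "Cod C t = Dom C m" and t: "m \<cdot> t = \<phi>"
    by (rule product_factor[of H K \<phi> m h k]) (use \<phi> m in auto)
  have "t \<cdot> ?i = h"
    by (rule monic_cancel[OF m, of _ H]) (use comp_reduce[OF t, of ?i] \<phi> in simp_all)
  moreover have "t \<cdot> ?j = k"
    by (rule monic_cancel[OF m, of _ K]) (use comp_reduce[OF t, of ?j] \<phi> in simp_all)
  ultimately show ?thesis unfolding cooperating_def by (intro bexI[of _ t]) simp_all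
qed

lemma sub_leE:
  assumes "sub_le k z"
  obtains u where "u \<in> hom (Dom C k) (Dom C z)" "z \<cdot> u = k"
  using assms unfolding sub_le_def by blast

text \<open>The kernel of the pairing is the intersection of the kernels \<open>k\<close> and
  \<open>y\<close>, so \<open>k \<cdot> z\<close> has to be recognised as that intersection. It lies
  in \<open>y\<close> because a cooperator may be composed with \<open>k\<close>. Conversely, the
  pullback \<open>i\<close> of \<open>y\<close> along \<open>k\<close> commutes with
  \<open>h\<close> after cancelling \<open>k\<close>, hence lies in \<open>z\<close> by
  maximality.\<close>

lemma centraliser_of_kernel_subobject:
  assumes k: "kernel p k" and z: "centraliser h (Dom C k) z"
    and y: "centraliser (k \<cdot> h) (Cod C k) y" and g: "kernel g y"
  shows "kernel (pair p g) (k \<cdot> z)"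
proof -
  define G A where "G = Dom C k" and "A = Cod C k"
  note mk = kernel_monic[OF k]
  have mh: "monic h" "Cod C h = G" and mz: "monic z" "Cod C z = G" and hz: "huq_commutator_zero h z"
    and zmax: "\<And>i. \<lbrakk>monic i; Cod C i = G; huq_commutator_zero h i\<rbrakk> \<Longrightarrow> sub_le i z"
    using z unfolding centraliser_def subobject_def G_def by auto
  have my: "monic y" "Cod C y = A" and hy: "huq_commutator_zero (k \<cdot> h) y"
    and ymax: "\<And>i. \<lbrakk>monic i; Cod C i = A; huq_commutator_zero (k \<cdot> h) i\<rbrakk> \<Longrightarrow> sub_le i y"
    using y unfolding centraliser_def subobject_def A_def by auto
  have [simp]: "h \<in> Arr C" "z \<in> Arr C" "y \<in> Arr C" "k \<in> Arr C" "p \<in> Arr C" "g \<in> Arr C"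
    "Cod C h = G" "Cod C z = G" "Cod C y = A" "Dom C k = G" "Cod C k = A" "Dom C p = A" "Dom C g = A"
    using mh mz my monic_Arr kernel_hom[OF k] kernel_hom[OF g] G_def A_def by simp_all
  have [simp]: "A \<in> Obj C" using Cod_Obj[of k] by simp
  have hz': "cooperating h z" using hz huq_commutator_zero_iff[of h z] by simp
  have hy': "cooperating (k \<cdot> h) y" using hy huq_commutator_zero_iff[of "k \<cdot> h" y] by simp
  have "huq_commutator_zero (k \<cdot> h) (k \<cdot> z)"
    using cooperating_comp[OF hz', of k] huq_commutator_zero_iff[of "k \<cdot> h" "k \<cdot> z"] by simp
  then have "sub_le (k \<cdot> z) y" using ymax[of "k \<cdot> z"] monic_comp[OF mz(1) mk] by simp
  then obtain u where "u \<in> hom (Dom C (k \<cdot> z)) (Dom C y)" and u: "y \<cdot> u = k \<cdot> z"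
    by (rule sub_leE)
  then have [simp]: "u \<in> Arr C" "Dom C u = Dom C z" "Cod C u = Dom C y" by simp_all
  have pkz: "p \<cdot> (k \<cdot> z) = zero (Dom C z) (Cod C p)"
    using comp_reduce[OF kernel_hom(4)[OF k], of z] by simp
  have gkz: "g \<cdot> (k \<cdot> z) = zero (Dom C z) (Cod C g)"
    unfolding u[symmetric] using comp_reduce[OF kernel_hom(4)[OF g], of u] by simp
  have P: "proj1 (Cod C p) (Cod C g) \<cdot> pair p g = p" "proj2 (Cod C p) (Cod C g) \<cdot> pair p g = g"
    by simp_all
  note red = P[THEN comp_reduce]
  obtain i j where I: "pullback k y i j" using pullback_exists[of k y] by auto
  note [simp] = pullback_hom(4,5,6,7,8)[OF I, simplified] and ij = pullback_hom(9)[OF I]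
  have "cooperating (k \<cdot> h) (k \<cdot> i)"
    using cooperating_restrict[OF hy', of j] by (simp add: ij)
  then have "cooperating h i"
    by (rule cooperating_monic_cancel) (simp_all add: mk)
  then have "huq_commutator_zero h i" using huq_commutator_zero_iff[of h i] by simp
  then have "sub_le i z" using zmax[of i] pullback_monic[OF I my(1)] by simp
  then obtain v where "v \<in> hom (Dom C i) (Dom C z)" and v: "z \<cdot> v = i"
    by (rule sub_leE)
  then have [simp]: "v \<in> Arr C" "Dom C v = Dom C i" "Cod C v = Dom C z" by simp_all
  show ?thesis
  proof (rule kernelI)
    show "pair p g \<cdot> (k \<cdot> z) = zero (Dom C (k \<cdot> z)) (Cod C (pair p g))"
      by (rule prod_eqI[of "Cod C p" "Cod C g" _ "Dom C z"]) (simp_all add: red pkz gkz)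
    fix W a assume a: "a \<in> hom W (Dom C (pair p g))" and eq: "pair p g \<cdot> a = zero W (Cod C (pair p g))"
    have [simp]: "W \<in> Obj C" using a by auto
    note [simp] = a[simplified]
    have "p \<cdot> a = zero W (Cod C p)" "g \<cdot> a = zero W (Cod C g)"
      using red(1)[of a] red(2)[of a] eq by simp_all
    then obtain b where b: "b \<in> hom W G" "k \<cdot> b = a"
      using kernel_lift[OF k, of a W] by auto
    obtain c where c: "c \<in> hom W (Dom C y)" "y \<cdot> c = a"
      using kernel_lift[OF g, of a W] \<open>g \<cdot> a = zero W (Cod C g)\<close> by auto
    obtain w where w: "w \<in> hom W (Dom C i)" "i \<cdot> w = b"
      using pullback_lift[OF I, of b W c] b c by auto
    have "(k \<cdot> z) \<cdot> (v \<cdot> w) = a"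
      using comp_reduce[OF v, of w] w b by simp
    then show "\<exists>t\<in>hom W (Dom C (k \<cdot> z)). (k \<cdot> z) \<cdot> t = a"
      using w by (intro bexI[of _ "v \<cdot> w"]) simp_all
  qed (simp_all add: monic_comp[OF mz(1) mk])
qed

text \<open>Normality of \<open>k \<cdot> z\<close> lets \<open>B\<close> act on it by conjugation
  along \<open>s\<close>, so the action laws come from \<open>conjugation_action\<close>.
  Compatibility with \<open>\<xi>\<close> follows by cancelling \<open>k\<close>, uniqueness by
  cancelling \<open>z\<close>.\<close>

lemma restricted_action:
  assumes act: "action B G \<xi>" and pt: "point B p s" and k: "kernel p k" "Dom C k = G"
    and eq: "copair s k \<cdot> ker (retraction B G) = k \<cdot> \<xi>"
    and z: "monic z" "Cod C z = G" and kz: "kernel f (k \<cdot> z)"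
  shows "\<exists>!\<xi>'. action B (Dom C z) \<xi>' \<and> z \<cdot> \<xi>' = \<xi> \<cdot> flat_map B z"
proof -
  define Z where "Z = Dom C z"
  have [simp]: "B \<in> Obj C" "G \<in> Obj C" "\<xi> \<in> Arr C" "Dom C \<xi> = flat B G" "Cod C \<xi> = G"
    using act by (auto simp: action_def)
  have [simp]: "z \<in> Arr C" "Cod C z = G" "Dom C z = Z" "k \<in> Arr C" "Dom C k = G"
    using monic_Arr[OF z(1)] z k kernel_hom(2) Z_def by simp_all
  have [simp]: "Z \<in> Obj C" using Dom_Obj[of z] by simp
  have [simp]: "s \<in> Arr C" "Dom C s = B" "Cod C s = Cod C k"
    using pt kernel_hom(3)[OF k(1)] by (auto simp: point_def)
  obtain \<zeta> where \<zeta>: "\<zeta> \<in> hom (flat B Z) Z" "(k \<cdot> z) \<cdot> \<zeta> = copair s (k \<cdot> z) \<cdot> ker (retraction B Z)"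
    using conjugation_exists[OF kz, of s B] by auto
  note [simp] = \<zeta>(1)[simplified]
  have act': "action B Z \<zeta>"
    using conjugation_action[OF kernel_monic[OF kz], of s B \<zeta>] \<zeta>(2) by simp
  have "k \<cdot> (z \<cdot> \<zeta>) = (copair s k \<cdot> sum_map B z) \<cdot> ker (retraction B Z)" using \<zeta>(2) by simp
  also have "\<dots> = copair s k \<cdot> (ker (retraction B G) \<cdot> flat_map B z)"
    using ker_flat_map[of B z G] by (simp del: copair_sum_map)
  also have "\<dots> = k \<cdot> (\<xi> \<cdot> flat_map B z)" using comp_reduce[OF eq, of "flat_map B z"] by simp
  finally have res: "z \<cdot> \<zeta> = \<xi> \<cdot> flat_map B z"
    using monic_cancel[OF kernel_monic[OF k(1)], of "z \<cdot> \<zeta>" "flat B Z" "\<xi> \<cdot> flat_map B z"] by simp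
  show ?thesis
  proof (rule ex1I[of _ \<zeta>])
    show "\<xi>' = \<zeta>" if "action B (Dom C z) \<xi>' \<and> z \<cdot> \<xi>' = \<xi> \<cdot> flat_map B z" for \<xi>'
      using that res by (intro monic_cancel[OF z(1), of \<xi>' "flat B Z" \<zeta>]) (auto simp: action_def)
  qed (use act' res in simp)
qed

theorem centraliser_characteristic:
  assumes cent: "\<And>G' h'. normal_subobject h' G' \<Longrightarrow> \<exists>z. centraliser h' G' z \<and> normal_subobject z G'"
    and h: "characteristic h G"
  shows "(\<exists>z. centraliser h G z) \<and> (\<forall>z. centraliser h G z \<longrightarrow> characteristic z G)"
proof (intro conjI allI impI)
  have [simp]: "h \<in> Arr C" "Cod C h = G"
    using h monic_Arr unfolding characteristic_def subobject_def by auto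
  have [simp]: "G \<in> Obj C" using Cod_Obj[of h] by simp
  \<comment> \<open>\<open>G\<close> is the kernel of its own zero endomorphism; this is the case
    \<open>A = G\<close>.\<close>
  have "kernel (zero G G) (Id C G)"
    by (rule kernelI) (auto simp: monic_def)
  then have "normal_subobject h G"
    using characteristic_in_kernel_normal[of h "Id C G" "zero G G"] h by simp
  with cent show "\<exists>z. centraliser h G z" by blast
  fix z assume z: "centraliser h G z"
  then have mz: "monic z" "Cod C z = G" unfolding centraliser_def subobject_def by auto
  show "characteristic z G"
    unfolding characteristic_def
  proof (intro conjI allI impI)
    show "subobject z G" using mz by (simp add: subobject_def)
    fix B \<xi> assume act: "action B G \<xi>"
    obtain p s k where pt: "point B p s" and k: "kernel p k" "Dom C k = G"
      and eq: "copair s k \<cdot> ker (retraction B G) = k \<cdot> \<xi>"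
      by (rule semidirect_product[OF act])
    have "normal_subobject (k \<cdot> h) (Cod C k)"
      using characteristic_in_kernel_normal[OF _ k(1)] h k(2) by simp
    then obtain y g where y: "centraliser (k \<cdot> h) (Cod C k) y" and g: "kernel g y"
      using cent unfolding normal_subobject_def by blast
    have "kernel (pair p g) (k \<cdot> z)"
      using centraliser_of_kernel_subobject[OF k(1) _ y g] z k(2) by simp
    then show "\<exists>!\<xi>'. action B (Dom C z) \<xi>' \<and> z \<cdot> \<xi>' = \<xi> \<cdot> flat_map B z"
      by (rule restricted_action[OF act pt k eq mz])
  qed
qed

end

theorem proposition5p4:
  fixes C :: "('o, 'm) cat_data" and G :: 'o and h :: 'm
  assumes "semi_abelian C"
    and "\<And>G' h'. category.normal_subobject C h' G' \<Longrightarrow>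
      \<exists>z. category.centraliser C h' G' z \<and> category.normal_subobject C z G'"
    and "category.characteristic C h G"
  shows "(\<exists>z. category.centraliser C h G z) \<and>
    (\<forall>z. category.centraliser C h G z \<longrightarrow> category.characteristic C z G)"
  by (rule semi_abelian.centraliser_characteristic[OF assms])

end
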